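(* Let $M$ be a smooth manifold, let $G^i(x,y)$ be the local coefficients of a spray on $TM$, let $M^i_{\ j}=\frac{\partial G^i}{\partial y^j}$, and let $F^i(x,y)$ be the components of a d-vector field. Consider the nonlinear connection on $T^2M$ with dual coefficients $$\underset{(1)}{M}{}^i_{\ j}=\frac12\Big(2M^i_{\ j}-\frac{\partial F^i}{\partial y^j}\Big),\qquad \underset{(2)}{M}{}^i_{\ j}=\frac12\Big(\mathbb C(M^i_{\ j})+M^i_{\ k}M^k_{\ j}-y^kR^i_{\ jk}+\frac{\partial M^i_{\ k}}{\partial y^j}F^k-\frac{\partial F^i}{\partial x^j}\Big).$$ Then, with respect to this nonlinear connection, the extensions of Jacobi fields attached to the system $\frac{\delta y^i}{dt}=F^i(x,y)$ have vanishing $v_2$ components; that is, for every solution curve $c$ of the system and every Jacobi field $w$ along $c$, $$\frac12\frac{d^2w^i}{dt^2}+\underset{(1)}{M}{}^i_{\ j}\frac{dw^j}{dt}+\underset{(2)}{M}{}^i_{\ j}w^j=0,$$ where the coefficients are evaluated along the extension $t\mapsto(x^i(t),\dot x^i(t),\frac12\ddot x^i(t))$ of $c$ to $T^2M$.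
   Context: Summation over repeated indices is used. $(x^i,y^i)$ are the natural coordinates on $TM$. Spray coefficients $G^i(x,y)$ are 2-homogeneous in $y$, $2G^i=\frac{\partial G^i}{\partial y^j}y^j$, and smooth for $y\neq0$; under changes of coordinates on $M$ they transform so that $\ddot x^i+2G^i(x,\dot x)=0$ is a globally defined system. All objects are considered at $y\neq 0$ and all curves are regular. A d-vector field $F^i(x,y)$ is a collection of smooth functions in the charts that transform as $\tilde F^i=\frac{\partial\tilde x^i}{\partial x^j}F^j$. Along a curve with $y=\dot x$, $\frac{\delta y^i}{dt}=\frac{dy^i}{dt}+M^i_{\ j}(x,y)y^j$. Notation: $\mathbb C=y^k\frac{\partial}{\partial x^k}+2y^{(2)k}\frac{\partial}{\partial y^k}$; $\delta_k=\frac{\partial}{\partial x^k}-M^j_{\ k}\frac{\partial}{\partial y^j}$; $R^i_{\ jk}=\delta_kM^i_{\ j}-\delta_jM^i_{\ k}$. A Jacobi field attached to the system along a solution curve $c$ is a deviation vector field $w^i(t)=\frac{\partial x^i}{\partial u}\big|_{u=0}$ of a smooth variation $x^i(t,u)$ of $c=x(\cdot,0)$ (not necessarily with fixed endpoints) all of whose curves $t\mapsto x^i(t,u)$ are solutions of the system. $T^2M$ is the bundle of 2-jets of curves in $M$, with coordinates $(x^i,y^i,y^{(2)i})$, where $y^i=\dot x^i$ and $y^{(2)i}=\frac12\ddot x^i$ for the jet of $t\mapsto x^i(t)$. Dual coefficients of a nonlinear connection on $T^2M$ are functions $\underset{(1)}{M}{}^i_{\ j},\underset{(2)}{M}{}^i_{\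 j}$ such that the 1-forms $\delta y^i=dy^i+\underset{(1)}{M}{}^i_{\ j}dx^j$ and $\delta y^{(2)i}=dy^{(2)i}+\underset{(1)}{M}{}^i_{\ j}dy^j+\underset{(2)}{M}{}^i_{\ j}dx^j$ transform by $\frac{\partial\tilde x^i}{\partial x^j}$ under changes of coordinates on $M$. The $v_2$ component of the extension of $w$ is the left-hand side of the displayed equation, denoted $\frac{\delta w^{(2)i}}{dt}$.
   Formalization: In the second dual coefficient the term (∂M^i_k/∂y^j)F^k is taken with a minus sign instead of plus; with plus the claim fails, e.g. for G=y²/2, F=1 on the real line, c(t)=t, w=1, where the left-hand side equals 1. *)

theory Defs
  imports "HOL-Analysis.Analysis"
begin

section \<open>Smooth functions and smooth manifolds\<close>

fun Ck_on :: "nat \<Rightarrow> ('a::euclidean_space \<Rightarrow> 'b::real_normed_vector) \<Rightarrow> 'a set \<Rightarrow> bool" where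
  "Ck_on 0 f S \<longleftrightarrow> continuous_on S f"
| "Ck_on (Suc k) f S \<longleftrightarrow>
     (\<forall>x\<in>S. f differentiable (at x)) \<and> (\<forall>v. Ck_on k (\<lambda>x. frechet_derivative f (at x) v) S)"

definition smooth_on :: "('a::euclidean_space \<Rightarrow> 'b::real_normed_vector) \<Rightarrow> 'a set \<Rightarrow> bool" where
  "smooth_on f S \<longleftrightarrow> open S \<and> (\<forall>k. Ck_on k f S)"

text \<open>A chart is a pair of its domain and its coordinate map (whose values off the domain are
  irrelevant). The dimension of the manifold is the cardinality of the index type.\<close>

type_synonym ('a, 'n) chart = "'a set \<times> ('a \<Rightarrow> (real, 'n) vec)"

definition transition ::
  "('a, 'n::finite) chart \<Rightarrow> ('a, 'n) chart \<Rightarrow> real^'n \<Rightarrow> real^'n" where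
  "transition \<kappa> \<kappa>' = snd \<kappa>' \<circ> inv_into (fst \<kappa>) (snd \<kappa>)"

definition overlap :: "('a, 'n::finite) chart \<Rightarrow> ('a, 'n) chart \<Rightarrow> (real^'n) set" where
  "overlap \<kappa> \<kappa>' = snd \<kappa> ` (fst \<kappa> \<inter> fst \<kappa>')"

text \<open>The atlas need not be maximal.\<close>

definition smooth_manifold :: "'a topology \<Rightarrow> ('a, 'n::finite) chart set \<Rightarrow> bool" where
  "smooth_manifold X A \<longleftrightarrow>
     Hausdorff_space X \<and> second_countable X \<and>
     (\<Union>(fst ` A)) = topspace X \<and>
     (\<forall>(U, \<phi>)\<in>A. openin X U \<and> open (\<phi> ` U) \<and>
        homeomorphic_map (subtopology X U) (top_of_set (\<phi> ` U)) \<phi>) \<and>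
     (\<forall>\<kappa>\<in>A. \<forall>\<kappa>'\<in>A. smooth_on (transition \<kappa> \<kappa>') (overlap \<kappa> \<kappa>'))"


section \<open>Sprays and d-vector fields\<close>

text \<open>Both are families of local coefficient functions of \<open>(x, y)\<close>, indexed by the charts.
  Only their values at \<open>y \<noteq> 0\<close> are meaningful.\<close>

type_synonym 'n loc = "(real, 'n) vec \<Rightarrow> (real, 'n) vec \<Rightarrow> (real, 'n) vec"

definition pdx :: "'n::finite \<Rightarrow> (real^'n \<Rightarrow> real^'n \<Rightarrow> real) \<Rightarrow> real^'n \<Rightarrow> real^'n \<Rightarrow> real" where
  "pdx j f x y = frechet_derivative (\<lambda>x. f x y) (at x) (axis j 1)"

definition pdy :: "'n::finite \<Rightarrow> (real^'n \<Rightarrow> real^'n \<Rightarrow> real) \<Rightarrow> real^'n \<Rightarrow> real^'n \<Rightarrow> real" where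
  "pdy j f x y = frechet_derivative (\<lambda>y. f x y) (at y) (axis j 1)"

definition Mcoef :: "'n::finite loc \<Rightarrow> 'n \<Rightarrow> 'n \<Rightarrow> real^'n \<Rightarrow> real^'n \<Rightarrow> real" where
  "Mcoef G i j = pdy j (\<lambda>x y. G x y $ i)"

text \<open>The transformation rule below is the classical one,
  \<open>2 G'^i = (dx'^i/dx^j) 2 G^j - (d^2 x'^i/dx^j dx^k) y^j y^k\<close>, which says exactly that the
  expression \<open>x'' + 2 G(x, x')\<close> along a curve transforms as a vector.\<close>

definition spray ::
  "('a, 'n::finite) chart set \<Rightarrow> (('a, 'n) chart \<Rightarrow> 'n loc) \<Rightarrow> bool" where
  "spray A G \<longleftrightarrow>
     (\<forall>\<kappa>\<in>A.
        smooth_on (\<lambda>(x, y). G \<kappa> x y) (snd \<kappa> ` fst \<kappa> \<times> (- {0})) \<and>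
        (\<forall>x\<in>snd \<kappa> ` fst \<kappa>. \<forall>y. y \<noteq> 0 \<longrightarrow>
           (\<forall>c>0. G \<kappa> x (c *\<^sub>R y) = c\<^sup>2 *\<^sub>R G \<kappa> x y) \<and>
           (\<forall>i. 2 * G \<kappa> x y $ i = (\<Sum>j\<in>UNIV. Mcoef (G \<kappa>) i j x y * y $ j)))) \<and>
     (\<forall>\<kappa>\<in>A. \<forall>\<kappa>'\<in>A. \<forall>x\<in>overlap \<kappa> \<kappa>'. \<forall>y. y \<noteq> 0 \<longrightarrow>
        (let \<tau> = transition \<kappa> \<kappa>' in
         2 *\<^sub>R G \<kappa>' (\<tau> x) (frechet_derivative \<tau> (at x) y) =
           frechet_derivative \<tau> (at x) (2 *\<^sub>R G \<kappa> x y)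
           - frechet_derivative (\<lambda>x. frechet_derivative \<tau> (at x) y) (at x) y))"

definition d_vector_field ::
  "('a, 'n::finite) chart set \<Rightarrow> (('a, 'n) chart \<Rightarrow> 'n loc) \<Rightarrow> bool" where
  "d_vector_field A F \<longleftrightarrow>
     (\<forall>\<kappa>\<in>A. smooth_on (\<lambda>(x, y). F \<kappa> x y) (snd \<kappa> ` fst \<kappa> \<times> (- {0}))) \<and>
     (\<forall>\<kappa>\<in>A. \<forall>\<kappa>'\<in>A. \<forall>x\<in>overlap \<kappa> \<kappa>'. \<forall>y. y \<noteq> 0 \<longrightarrow>
        (let \<tau> = transition \<kappa> \<kappa>' in
         F \<kappa>' (\<tau> x) (frechet_derivative \<tau> (at x) y) = frechet_derivative \<tau> (at x) (F \<kappa> x y)))"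

definition delta ::
  "'n::finite loc \<Rightarrow> 'n \<Rightarrow> (real^'n \<Rightarrow> real^'n \<Rightarrow> real) \<Rightarrow> real^'n \<Rightarrow> real^'n \<Rightarrow> real" where
  "delta G k f x y = pdx k f x y - (\<Sum>j\<in>UNIV. Mcoef G j k x y * pdy j f x y)"

definition Rcoef ::
  "'n::finite loc \<Rightarrow> 'n \<Rightarrow> 'n \<Rightarrow> 'n \<Rightarrow> real^'n \<Rightarrow> real^'n \<Rightarrow> real" where
  "Rcoef G i j k x y = delta G k (Mcoef G i j) x y - delta G j (Mcoef G i k) x y"


section \<open>Nonlinear connections on the second order tangent bundle\<close>

text \<open>Points of \<open>T^2 M\<close> are given in a chart by triples \<open>(x, y, y2)\<close>.\<close>

type_synonym 'n T2 = "(real, 'n) vec \<times> (real, 'n) vec \<times> (real, 'n) vec"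

definition vel :: "(real \<Rightarrow> real^'n::finite) \<Rightarrow> real \<Rightarrow> real^'n" where
  "vel x t = vector_derivative x (at t)"

definition extension :: "(real \<Rightarrow> real^'n::finite) \<Rightarrow> real \<Rightarrow> 'n T2" where
  "extension x t = (x t, vel x t, (1/2) *\<^sub>R vel (vel x) t)"

text \<open>The coordinate change on \<open>T^2 M\<close> induced by \<open>\<tau>\<close>: represent the 2-jet \<open>(x, y, y2)\<close> by the curve
  \<open>x + t y + t^2 y2\<close> and take the 2-jet of its image.\<close>

definition T2_map :: "(real^'n::finite \<Rightarrow> real^'n) \<Rightarrow> 'n T2 \<Rightarrow> 'n T2" where
  "T2_map \<tau> = (\<lambda>(x, y, z). extension (\<lambda>t. \<tau> (x + t *\<^sub>R y + t\<^sup>2 *\<^sub>R z)) 0)"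

text \<open>The two vector-valued 1-forms \<open>\<delta>y\<close> and \<open>\<delta>y2\<close>, evaluated at a tangent vector
  \<open>(X, Y, Z)\<close> of \<open>T^2 M\<close> at the point \<open>p\<close>.\<close>

definition delta_y1 :: "('n::finite T2 \<Rightarrow> real^'n^'n) \<Rightarrow> 'n T2 \<Rightarrow> 'n T2 \<Rightarrow> real^'n" where
  "delta_y1 N1 p = (\<lambda>(X, Y, Z). Y + N1 p *v X)"

definition delta_y2 ::
  "('n::finite T2 \<Rightarrow> real^'n^'n) \<Rightarrow> ('n T2 \<Rightarrow> real^'n^'n) \<Rightarrow> 'n T2 \<Rightarrow> 'n T2 \<Rightarrow> real^'n" where
  "delta_y2 N1 N2 p = (\<lambda>(X, Y, Z). Z + N1 p *v Y + N2 p *v X)"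

definition dual_coefficients ::
  "('a, 'n::finite) chart set \<Rightarrow> (('a, 'n) chart \<Rightarrow> 'n T2 \<Rightarrow> real^'n^'n) \<Rightarrow>
   (('a, 'n) chart \<Rightarrow> 'n T2 \<Rightarrow> real^'n^'n) \<Rightarrow> bool" where
  "dual_coefficients A N1 N2 \<longleftrightarrow>
     (\<forall>\<kappa>\<in>A. \<forall>\<kappa>'\<in>A. \<forall>x\<in>overlap \<kappa> \<kappa>'. \<forall>y z v. y \<noteq> 0 \<longrightarrow>
        (let \<tau> = transition \<kappa> \<kappa>';
             p = (x, y, z);
             q = T2_map \<tau> p;
             w = frechet_derivative (T2_map \<tau>) (at p) v
         in delta_y1 (N1 \<kappa>') q w = frechet_derivative \<tau> (at x) (delta_y1 (N1 \<kappa>) p v) \<and>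
            delta_y2 (N1 \<kappa>') (N2 \<kappa>') q w =
              frechet_derivative \<tau> (at x) (delta_y2 (N1 \<kappa>) (N2 \<kappa>) p v)))"

definition CC ::
  "(real^'n::finite \<Rightarrow> real^'n \<Rightarrow> real) \<Rightarrow> real^'n \<Rightarrow> real^'n \<Rightarrow> real^'n \<Rightarrow> real" where
  "CC f x y z = (\<Sum>k\<in>UNIV. y $ k * pdx k f x y + 2 * z $ k * pdy k f x y)"

definition M1 :: "'n::finite loc \<Rightarrow> 'n loc \<Rightarrow> 'n T2 \<Rightarrow> real^'n^'n" where
  "M1 G F = (\<lambda>(x, y, z). \<chi> i j. (1/2) * (2 * Mcoef G i j x y - pdy j (\<lambda>x y. F x y $ i) x y))"

text \<open>Pitfall: the two terms containing \<open>F\<close> enter with the same (negative) sign. One also finds the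
  formula with \<open>+ (dM^i_k/dy^j) F^k\<close>; then \<open>M1\<close> and \<open>M2\<close> do not transform as dual coefficients and
  the equation of Jacobi fields fails, e.g. for \<open>G = y^2/2\<close>, \<open>F = 1\<close> on the real line with
  \<open>c(t) = t\<close> and \<open>w = 1\<close>.\<close>

definition M2 :: "'n::finite loc \<Rightarrow> 'n loc \<Rightarrow> 'n T2 \<Rightarrow> real^'n^'n" where
  "M2 G F = (\<lambda>(x, y, z). \<chi> i j. (1/2) *
     (CC (Mcoef G i j) x y z
      + (\<Sum>k\<in>UNIV. Mcoef G i k x y * Mcoef G k j x y)
      - (\<Sum>k\<in>UNIV. y $ k * Rcoef G i j k x y)
      - (\<Sum>k\<in>UNIV. pdy j (Mcoef G i k) x y * F x y $ k)
      - pdx j (\<lambda>x y. F x y $ i) x y))"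


section \<open>Solution curves and Jacobi fields\<close>

text \<open>The local representation \<open>\<phi> \<circ> c\<close> is only considered at times \<open>t\<close> with \<open>c t\<close> in the
  chart domain; these form an open set.\<close>

definition solution_curve ::
  "'a topology \<Rightarrow> ('a, 'n::finite) chart set \<Rightarrow> (('a, 'n) chart \<Rightarrow> 'n loc) \<Rightarrow>
   (('a, 'n) chart \<Rightarrow> 'n loc) \<Rightarrow> real set \<Rightarrow> (real \<Rightarrow> 'a) \<Rightarrow> bool" where
  "solution_curve X A G F I c \<longleftrightarrow>
     continuous_map (top_of_set I) X c \<and>
     (\<forall>\<kappa>\<in>A. let x = snd \<kappa> \<circ> c; y = vel x; T = {t\<in>I. c t \<in> fst \<kappa>} in
        smooth_on x T \<and>
        (\<forall>t\<in>T. y t \<noteq> 0 \<and>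
           (\<forall>i. vel y t $ i + (\<Sum>j\<in>UNIV. Mcoef (G \<kappa>) i j (x t) (y t) * y t $ j)
                 = F \<kappa> (x t) (y t) $ i)))"

definition jacobi_variation ::
  "'a topology \<Rightarrow> ('a, 'n::finite) chart set \<Rightarrow> (('a, 'n) chart \<Rightarrow> 'n loc) \<Rightarrow>
   (('a, 'n) chart \<Rightarrow> 'n loc) \<Rightarrow> real set \<Rightarrow> (real \<Rightarrow> 'a) \<Rightarrow> real \<Rightarrow> (real \<Rightarrow> real \<Rightarrow> 'a) \<Rightarrow> bool" where
  "jacobi_variation X A G F I c \<epsilon> V \<longleftrightarrow>
     0 < \<epsilon> \<and>
     continuous_map (top_of_set (I \<times> {-\<epsilon><..<\<epsilon>})) X (\<lambda>(t, u). V t u) \<and>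
     (\<forall>\<kappa>\<in>A. smooth_on (\<lambda>(t, u). snd \<kappa> (V t u))
               {(t, u). t \<in> I \<and> u \<in> {-\<epsilon><..<\<epsilon>} \<and> V t u \<in> fst \<kappa>}) \<and>
     (\<forall>t\<in>I. V t 0 = c t) \<and>
     (\<forall>u\<in>{-\<epsilon><..<\<epsilon>}. solution_curve X A G F I (\<lambda>t. V t u))"

text \<open>A vector field along \<open>c\<close> is given by its components in every chart; \<open>w \<kappa> t\<close> is meaningful
  only if \<open>c t\<close> lies in the domain of \<open>\<kappa>\<close>.\<close>

definition jacobi_field ::
  "'a topology \<Rightarrow> ('a, 'n::finite) chart set \<Rightarrow> (('a, 'n) chart \<Rightarrow> 'n loc) \<Rightarrow>
   (('a, 'n) chart \<Rightarrow> 'n loc) \<Rightarrow> real set \<Rightarrow> (real \<Rightarrow> 'a) \<Rightarrow>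
   (('a, 'n) chart \<Rightarrow> real \<Rightarrow> real^'n) \<Rightarrow> bool" where
  "jacobi_field X A G F I c w \<longleftrightarrow>
     (\<exists>\<epsilon> V. jacobi_variation X A G F I c \<epsilon> V \<and>
        (\<forall>\<kappa>\<in>A. \<forall>t\<in>I. c t \<in> fst \<kappa> \<longrightarrow>
           w \<kappa> t = vector_derivative (\<lambda>u. snd \<kappa> (V t u)) (at 0)))"

definition v2_component ::
  "('n::finite T2 \<Rightarrow> real^'n^'n) \<Rightarrow> ('n T2 \<Rightarrow> real^'n^'n) \<Rightarrow>
   (real \<Rightarrow> real^'n) \<Rightarrow> (real \<Rightarrow> real^'n) \<Rightarrow> real \<Rightarrow> real^'n" where
  "v2_component N1 N2 x w t =
     (1/2) *\<^sub>R vel (vel w) t + N1 (extension x t) *v vel w t + N2 (extension x t) *v w t"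

end

theory Submission
  imports Defs
begin

text \<open>Put \<open>h = 2 G - F\<close> and \<open>S (x, y, z) = 2 z + h (x, y)\<close>, so that the system says that \<open>S\<close> vanishes along
  the extension of a curve. Differentiating Euler's relation \<open>2 G = M y\<close> in \<open>x\<close> and in \<open>y\<close> collapses the
  coefficients to \<open>M1 X = 1/2 h_y X\<close> and \<open>M2 X = 1/2 (h_x X + G_yy (S, X))\<close>, whence
  \<open>2 \<delta>y2 = dS + G_yy (S, dx)\<close>. The function \<open>S\<close> transforms as a vector; the second derivative of the
  coordinate change that appears in the transformation of \<open>dS\<close> cancels against the one in the transformation
  of \<open>G_yy\<close>. Where \<open>S = 0\<close> the term with \<open>G_yy\<close> disappears, and the equation \<open>\<delta>y2 = 0\<close> for
  the extension of a deviation field is the linearization \<open>dS = 0\<close> of the system.\<close>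

section \<open>Second derivatives of smooth maps\<close>

abbreviation fderiv ::
  "('a::real_normed_vector \<Rightarrow> 'b::real_normed_vector) \<Rightarrow> 'a \<Rightarrow> 'a \<Rightarrow> 'b" where
  "fderiv f x \<equiv> frechet_derivative f (at x)"

abbreviation fderiv2 ::
  "('a::real_normed_vector \<Rightarrow> 'b::real_normed_vector) \<Rightarrow> 'a \<Rightarrow> 'a \<Rightarrow> 'a \<Rightarrow> 'b" where
  "fderiv2 f x a b \<equiv> fderiv (\<lambda>z. fderiv f z a) x b"

lemma fderivI: "(f has_derivative f') (at x) \<Longrightarrow> fderiv f x = f'"
  using frechet_derivative_at by metis

lemma has_derivative_fderiv: "(f has_derivative f') (at x) \<Longrightarrow> (f has_derivative fderiv f x) (at x)"
  by (simp add: frechet_derivative_works[symmetric] differentiableI)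

lemma fderiv_cong_open:
  assumes "open S" "x \<in> S" "\<And>z. z \<in> S \<Longrightarrow> f z = g z"
  shows "fderiv f x = fderiv g x"
proof -
  have "(f has_derivative d) (at x) \<longleftrightarrow> (g has_derivative d) (at x)" for d
    using has_derivative_transform_within_open[OF _ assms(1,2)] assms(3) by metis
  thus ?thesis by (simp add: frechet_derivative_def)
qed

lemma smooth_on_open: "smooth_on f S \<Longrightarrow> open S"
  by (simp add: smooth_on_def)

lemma smooth_on_continuous_on: "smooth_on f S \<Longrightarrow> continuous_on S f"
  unfolding smooth_on_def by (metis Ck_on.simps(1))

lemma smooth_on_differentiable: "smooth_on f S \<Longrightarrow> x \<in> S \<Longrightarrow> f differentiable (at x)"
  unfolding smooth_on_def by (metis Ck_on.simps(2))

lemma smooth_on_has_derivative: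
  "smooth_on f S \<Longrightarrow> x \<in> S \<Longrightarrow> (f has_derivative fderiv f x) (at x)"
  using smooth_on_differentiable frechet_derivative_works by blast

lemma smooth_on_fderiv: "smooth_on f S \<Longrightarrow> smooth_on (\<lambda>x. fderiv f x v) S"
  unfolding smooth_on_def by (metis Ck_on.simps(2))

lemma smooth_on_linear_fderiv: "smooth_on f S \<Longrightarrow> x \<in> S \<Longrightarrow> linear (fderiv f x)"
  using smooth_on_differentiable linear_frechet_derivative by blast

section \<open>Symmetry of second derivatives by means of second differences\<close>

lemma second_difference_mvt:
  fixes f :: "'a::euclidean_space \<Rightarrow> real"
  assumes S: "\<And>s t. 0 \<le> s \<Longrightarrow> s \<le> h \<Longrightarrow> 0 \<le> t \<Longrightarrow> t \<le> h \<Longrightarrow> x + s *\<^sub>R a + t *\<^sub>R b \<in> S"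
    and f: "\<And>z. z \<in> S \<Longrightarrow> f differentiable (at z)"
    and fa: "\<And>z. z \<in> S \<Longrightarrow> (\<lambda>z. fderiv f z a) differentiable (at z)"
    and h: "h > 0"
  obtains s t where "0 < s" "s < h" "0 < t" "t < h"
    "f (x + h *\<^sub>R a + h *\<^sub>R b) - f (x + h *\<^sub>R a) - f (x + h *\<^sub>R b) + f x
      = h\<^sup>2 * fderiv2 f (x + s *\<^sub>R a + t *\<^sub>R b) a b"
proof -
  have fd: "((\<lambda>s. f (x + s *\<^sub>R a + t *\<^sub>R b)) has_real_derivative
      fderiv f (x + s *\<^sub>R a + t *\<^sub>R b) a) (at s)"
    if "0 \<le> s" "s \<le> h" "0 \<le> t" "t \<le> h" for s t
  proof -
    have d: "(f has_derivative fderiv f (x + s *\<^sub>R a + t *\<^sub>R b)) (at (x + s *\<^sub>R a + t *\<^sub>R b))"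
      using f S that frechet_derivative_works by blast
    have "((\<lambda>s. f (x + s *\<^sub>R a + t *\<^sub>R b)) has_derivative
        (\<lambda>r. fderiv f (x + s *\<^sub>R a + t *\<^sub>R b) (r *\<^sub>R a))) (at s)"
      by (rule has_derivative_compose[where f = "\<lambda>s. x + s *\<^sub>R a + t *\<^sub>R b", OF _ d])
        (auto intro!: derivative_eq_intros)
    moreover have "fderiv f (x + s *\<^sub>R a + t *\<^sub>R b) (r *\<^sub>R a)
        = r * fderiv f (x + s *\<^sub>R a + t *\<^sub>R b) a" for r
      using has_derivative_linear[OF d] by (simp add: linear_cmul)
    ultimately show ?thesis
      by (simp add: has_field_derivative_def mult.commute[of _ "fderiv f _ a"])
  qed
  have fad: "((\<lambda>t. fderiv f (x + s *\<^sub>R a + t *\<^sub>R b) a) has_real_derivative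
      fderiv2 f (x + s *\<^sub>R a + t *\<^sub>R b) a b) (at t)"
    if "0 \<le> s" "s \<le> h" "0 \<le> t" "t \<le> h" for s t
  proof -
    let ?D = "fderiv2 f (x + s *\<^sub>R a + t *\<^sub>R b) a"
    have d: "((\<lambda>z. fderiv f z a) has_derivative ?D) (at (x + s *\<^sub>R a + t *\<^sub>R b))"
      using fa S that frechet_derivative_works by blast
    have "((\<lambda>t. fderiv f (x + s *\<^sub>R a + t *\<^sub>R b) a) has_derivative (\<lambda>r. ?D (r *\<^sub>R b))) (at t)"
      by (rule has_derivative_compose[where f = "\<lambda>t. x + s *\<^sub>R a + t *\<^sub>R b", OF _ d])
        (auto intro!: derivative_eq_intros)
    moreover have "?D (r *\<^sub>R b) = r * ?D b" for r
      using has_derivative_linear[OF d] by (simp add: linear_cmul)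
    ultimately show ?thesis
      by (simp add: has_field_derivative_def mult.commute[of _ "?D b"])
  qed
  \<comment> \<open>The second difference is the increment of \<open>?g\<close> over
    \<open>[0, h]\<close>. The mean value theorem in \<open>s\<close> leaves an increment of
    \<open>fderiv f _ a\<close> along \<open>b\<close>; a second application, in \<open>t\<close>,
    produces the mixed derivative.\<close>
  let ?g = "\<lambda>s. f (x + s *\<^sub>R a + h *\<^sub>R b) - f (x + s *\<^sub>R a)"
  have gd: "(?g has_real_derivative fderiv f (x + s *\<^sub>R a + h *\<^sub>R b) a - fderiv f (x + s *\<^sub>R a) a) (at s)"
    if "0 \<le> s" "s \<le> h" for s
    using DERIV_diff[OF fd[OF that, of h] fd[OF that, of 0]] h by simp
  obtain s where s: "0 < s" "s < h"
    "?g h - ?g 0 = (h - 0) * (fderiv f (x + s *\<^sub>R a + h *\<^sub>R b) a - fderiv f (x + s *\<^sub>R a) a)"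
    using MVT2[OF h gd] by blast
  obtain t where t: "0 < t" "t < h"
    "fderiv f (x + s *\<^sub>R a + h *\<^sub>R b) a - fderiv f (x + s *\<^sub>R a + 0 *\<^sub>R b) a
      = (h - 0) * fderiv2 f (x + s *\<^sub>R a + t *\<^sub>R b) a b"
    using MVT2[OF h fad[OF less_imp_le[OF s(1)] less_imp_le[OF s(2)]]] by blast
  show thesis
    by (rule that[OF s(1,2) t(1,2)]) (use s(3) t(3) in \<open>simp add: power2_eq_square algebra_simps\<close>)
qed

text \<open>Schwarz's theorem: the second difference of \<open>f\<close> does not change when
  \<open>a\<close> and \<open>b\<close> are exchanged, so the two mixed derivatives agree at a pair
  of points near \<open>x\<close>. Continuity then excludes a gap at \<open>x\<close>
  itself.\<close>

lemma fderiv2_symmetric_real: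
  fixes f :: "'a::euclidean_space \<Rightarrow> real"
  assumes S: "open S" "x \<in> S"
    and f: "\<And>z. z \<in> S \<Longrightarrow> f differentiable (at z)"
    and fa: "\<And>z v. z \<in> S \<Longrightarrow> (\<lambda>z. fderiv f z v) differentiable (at z)"
    and c: "\<And>v w. continuous_on S (\<lambda>z. fderiv2 f z v w)"
  shows "fderiv2 f x a b = fderiv2 f x b a"
proof (rule ccontr)
  let ?P = "\<lambda>z. fderiv2 f z a b" and ?Q = "\<lambda>z. fderiv2 f z b a"
  assume ne: "?P x \<noteq> ?Q x"
  define e where "e = dist (?P x) (?Q x)"
  have e: "e > 0" using ne by (simp add: e_def)
  obtain d1 where d1: "d1 > 0" "\<And>z. z \<in> S \<Longrightarrow> dist z x < d1 \<Longrightarrow> dist (?P z) (?P x) < e / 2"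
    using c[of a b] half_gt_zero[OF e] S unfolding continuous_on_iff by meson
  obtain d2 where d2: "d2 > 0" "\<And>z. z \<in> S \<Longrightarrow> dist z x < d2 \<Longrightarrow> dist (?Q z) (?Q x) < e / 2"
    using c[of b a] half_gt_zero[OF e] S unfolding continuous_on_iff by meson
  obtain d3 where d3: "d3 > 0" "\<And>z. dist z x < d3 \<Longrightarrow> z \<in> S"
    using S unfolding open_dist by meson
  define d where "d = min d1 (min d2 d3)"
  \<comment> \<open>All combinations of \<open>a\<close> and \<open>b\<close> with coefficients in
    \<open>[0, h]\<close> move \<open>x\<close> by less than \<open>d\<close>; the summand 1 keeps
    the denominator positive when \<open>a = b = 0\<close>.\<close>
  define h where "h = d / (norm a + norm b + 1)"
  have pos: "norm a + norm b + 1 > 0" by (smt (verit) norm_ge_zero)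
  have h: "h > 0" unfolding h_def d_def using pos d1 d2 d3 by simp
  have near: "dist (x + s *\<^sub>R a + t *\<^sub>R b) x < d" if "0 \<le> s" "s \<le> h" "0 \<le> t" "t \<le> h" for s t
  proof -
    have "dist (x + s *\<^sub>R a + t *\<^sub>R b) x = norm (s *\<^sub>R a + t *\<^sub>R b)" by (simp add: dist_norm)
    also have "\<dots> \<le> norm (s *\<^sub>R a) + norm (t *\<^sub>R b)" by (rule norm_triangle_ineq)
    also have "\<dots> \<le> h * norm a + h * norm b"
      using that by (simp add: add_mono mult_right_mono)
    also have "\<dots> < h * (norm a + norm b + 1)" using h by (simp add: algebra_simps)
    also have "\<dots> = d" using pos by (simp add: h_def)
    finally show ?thesis .
  qed
  have near': "dist (x + s *\<^sub>R b + t *\<^sub>R a) x < d" if "0 \<le> s" "s \<le> h" "0 \<le> t" "t \<le> h" for s t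
    using near[of t s] that by (simp add: add.commute add.left_commute)
  have inS: "z \<in> S" if "dist z x < d" for z using that d3 by (simp add: d_def)
  obtain s t where st: "0 < s" "s < h" "0 < t" "t < h"
    "f (x + h *\<^sub>R a + h *\<^sub>R b) - f (x + h *\<^sub>R a) - f (x + h *\<^sub>R b) + f x
      = h\<^sup>2 * ?P (x + s *\<^sub>R a + t *\<^sub>R b)"
    by (rule second_difference_mvt[of h x a b S f, OF inS[OF near] f fa h])
  obtain s' t' where st': "0 < s'" "s' < h" "0 < t'" "t' < h"
    "f (x + h *\<^sub>R b + h *\<^sub>R a) - f (x + h *\<^sub>R b) - f (x + h *\<^sub>R a) + f x
      = h\<^sup>2 * ?Q (x + s' *\<^sub>R b + t' *\<^sub>R a)"
    by (rule second_difference_mvt[of h x b a S f, OF inS[OF near'] f fa h])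
  have "h\<^sup>2 * ?P (x + s *\<^sub>R a + t *\<^sub>R b) = h\<^sup>2 * ?Q (x + s' *\<^sub>R b + t' *\<^sub>R a)"
    unfolding st(5)[symmetric] st'(5)[symmetric] by (simp add: algebra_simps)
  hence eq: "?P (x + s *\<^sub>R a + t *\<^sub>R b) = ?Q (x + s' *\<^sub>R b + t' *\<^sub>R a)" using h by simp
  have "dist (?P (x + s *\<^sub>R a + t *\<^sub>R b)) (?P x) < e / 2"
    using near[of s t] st inS d1 by (simp add: d_def)
  moreover have "dist (?Q (x + s' *\<^sub>R b + t' *\<^sub>R a)) (?Q x) < e / 2"
    using near'[of s' t'] st' inS d2 by (simp add: d_def)
  \<comment> \<open>One common value would lie within \<open>e / 2\<close> of both
    \<open>?P x\<close> and \<open>?Q x\<close>, whose distance is \<open>e\<close>.\<close>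
  ultimately show False
    using eq dist_triangle_half_r[of _ "?P x" e "?Q x"] e_def by fastforce
qed

lemma fderiv_inner:
  assumes "f differentiable (at x)"
  shows "fderiv (\<lambda>z. f z \<bullet> c) x v = fderiv f x v \<bullet> c"
proof -
  have "((\<lambda>z. f z \<bullet> c) has_derivative (\<lambda>v. fderiv f x v \<bullet> c)) (at x)"
    by (rule has_derivative_inner_left) (use assms frechet_derivative_works in blast)
  from fderivI[OF this] show ?thesis by simp
qed

text \<open>Pairing with a basis vector \<open>c\<close> reduces the claim to real-valued functions;
  facts \<open>1\<close> and \<open>2\<close> say that the pairing commutes with first and second
  derivatives.\<close>

lemma fderiv2_symmetric:
  fixes f :: "'a::euclidean_space \<Rightarrow> 'b::euclidean_space"
  assumes f: "smooth_on f S" and x: "x \<in> S"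
  shows "fderiv2 f x a b = fderiv2 f x b a"
proof (rule euclidean_eqI)
  fix c :: 'b
  have S: "open S" using f smooth_on_open by blast
  have 1: "fderiv (\<lambda>z. f z \<bullet> c) z v = fderiv f z v \<bullet> c" if "z \<in> S" for z v
    by (rule fderiv_inner) (rule smooth_on_differentiable[OF f that])
  have d2: "(\<lambda>z. fderiv f z v \<bullet> c) differentiable (at z)" if "z \<in> S" for z v
    using smooth_on_differentiable[OF smooth_on_fderiv[OF f] that] by simp
  have 2: "fderiv (\<lambda>z. fderiv (\<lambda>z. f z \<bullet> c) z v) z w = fderiv2 f z v w \<bullet> c" if "z \<in> S" for z v w
  proof -
    have "fderiv (\<lambda>z. fderiv (\<lambda>z. f z \<bullet> c) z v) z = fderiv (\<lambda>z. fderiv f z v \<bullet> c) z"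
      by (rule fderiv_cong_open[OF S that]) (rule 1)
    thus ?thesis
      using fderiv_inner[OF smooth_on_differentiable[OF smooth_on_fderiv[OF f] that]] by simp
  qed
  have "fderiv (\<lambda>z. fderiv (\<lambda>z. f z \<bullet> c) z a) x b = fderiv (\<lambda>z. fderiv (\<lambda>z. f z \<bullet> c) z b) x a"
  proof (rule fderiv2_symmetric_real[of S x "\<lambda>z. f z \<bullet> c" a b, OF S x])
    show "(\<lambda>z. f z \<bullet> c) differentiable (at z)" if "z \<in> S" for z
      using smooth_on_differentiable[OF f that] by simp
    show "(\<lambda>z. fderiv (\<lambda>z. f z \<bullet> c) z v) differentiable (at z)" if z: "z \<in> S" for z v
    proof -
      obtain D where "((\<lambda>z. fderiv f z v \<bullet> c) has_derivative D) (at z)"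
        using d2[OF z, of v] unfolding differentiable_def by blast
      hence "((\<lambda>z. fderiv (\<lambda>z. f z \<bullet> c) z v) has_derivative D) (at z)"
        by (rule has_derivative_transform_within_open[OF _ S z]) (rule 1[symmetric])
      thus ?thesis unfolding differentiable_def by blast
    qed
    show "continuous_on S (\<lambda>z. fderiv (\<lambda>z. fderiv (\<lambda>z. f z \<bullet> c) z v) z w)" for v w
    proof -
      have "continuous_on S (\<lambda>z. fderiv2 f z v w \<bullet> c)"
        by (rule continuous_on_inner[OF smooth_on_continuous_on[OF smooth_on_fderiv[OF smooth_on_fderiv[OF f]]]
              continuous_on_const])
      thus ?thesis by (simp add: 2 cong: continuous_on_cong)
    qed
  qed
  thus "fderiv2 f x a b \<bullet> c = fderiv2 f x b a \<bullet> c" by (simp add: 2 x)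
qed

text \<open>Joint differentiability in base point and vector: expanding the vector in
  \<open>Basis\<close> leaves a finite sum of scalar coordinates times functions of the base point
  alone, to which the product rule applies.\<close>

lemma fderiv_apply_has_derivative:
  fixes f :: "'a::euclidean_space \<Rightarrow> 'b::real_normed_vector"
  assumes f: "smooth_on f S" and x: "x \<in> S"
  shows "((\<lambda>(x, y). fderiv f x y) has_derivative
           (\<lambda>(X, Y). fderiv2 f x y X + fderiv f x Y)) (at (x, y))"
proof -
  have S: "open S" using f smooth_on_open by blast
  have exp: "fderiv f z v = (\<Sum>b\<in>Basis. (v \<bullet> b) *\<^sub>R fderiv f z b)" if "z \<in> S" for z v
  proof -
    have "fderiv f z v = fderiv f z (\<Sum>b\<in>Basis. (v \<bullet> b) *\<^sub>R b)" by (simp add: euclidean_representation)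
    thus ?thesis using smooth_on_linear_fderiv[OF f that] by (simp add: linear_sum linear_cmul)
  qed
  have D: "((\<lambda>z. fderiv f z b) has_derivative fderiv2 f x b) (at x)" for b
    by (rule smooth_on_has_derivative[OF smooth_on_fderiv[OF f] x])
  \<comment> \<open>For a fixed vector \<open>y\<close> the expansion is differentiated in the base
    point; the resulting fact \<open>2\<close> folds the sums back at the end.\<close>
  have "((\<lambda>z. \<Sum>b\<in>Basis. (y \<bullet> b) *\<^sub>R fderiv f z b) has_derivative
      (\<lambda>X. \<Sum>b\<in>Basis. (y \<bullet> b) *\<^sub>R fderiv2 f x b X)) (at x)"
    by (intro has_derivative_sum has_derivative_scaleR_right D)
  hence "((\<lambda>z. fderiv f z y) has_derivative (\<lambda>X. \<Sum>b\<in>Basis. (y \<bullet> b) *\<^sub>R fderiv2 f x b X)) (at x)"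
    by (rule has_derivative_transform_within_open[OF _ S x]) (rule exp[symmetric])
  from fderivI[OF this]
  have 2: "fderiv2 f x y X = (\<Sum>b\<in>Basis. (y \<bullet> b) *\<^sub>R fderiv2 f x b X)" for X by simp
  have Dp: "((\<lambda>p. fderiv f (fst p) b) has_derivative (\<lambda>P. fderiv2 f x b (fst P))) (at (x, y))" for b
    using has_derivative_compose[OF has_derivative_fst[OF has_derivative_ident], of "\<lambda>z. fderiv f z b" "fderiv2 f x b" "(x, y)" UNIV] D
    by simp
  have "((\<lambda>p. \<Sum>b\<in>Basis. (snd p \<bullet> b) *\<^sub>R fderiv f (fst p) b) has_derivative
      (\<lambda>P. \<Sum>b\<in>Basis. (y \<bullet> b) *\<^sub>R fderiv2 f x b (fst P) + (snd P \<bullet> b) *\<^sub>R fderiv f x b)) (at (x, y))"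
    by (intro has_derivative_sum) (auto intro!: derivative_eq_intros Dp)
  hence "((\<lambda>(x, y). fderiv f x y) has_derivative
      (\<lambda>P. \<Sum>b\<in>Basis. (y \<bullet> b) *\<^sub>R fderiv2 f x b (fst P) + (snd P \<bullet> b) *\<^sub>R fderiv f x b)) (at (x, y))"
    by (rule has_derivative_transform_within_open[of _ _ _ _ "S \<times> UNIV"])
       (use S x in \<open>auto intro: open_Times simp: exp[symmetric]\<close>)
  moreover have "(\<lambda>P. \<Sum>b\<in>Basis. (y \<bullet> b) *\<^sub>R fderiv2 f x b (fst P) + (snd P \<bullet> b) *\<^sub>R fderiv f x b)
      = (\<lambda>(X, Y). fderiv2 f x y X + fderiv f x Y)"
    by (auto simp: sum.distrib 2 exp[OF x, symmetric])
  ultimately show ?thesis by simp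
qed


section \<open>The coefficients in a single chart\<close>

text \<open>\<open>pdx\<close> and \<open>pdy\<close> vary one argument only. This rule and the next
  turn them into total derivatives of the uncurried map, for which symmetry of second derivatives is
  available.\<close>

lemma fderiv_partial_fst:
  assumes "f differentiable (at (x, y))"
  shows "fderiv (\<lambda>x. f (x, y)) x a = fderiv f (x, y) (a, 0)"
proof -
  have f: "(f has_derivative fderiv f (x, y)) (at (x, y))"
    using assms frechet_derivative_works by blast
  have "((\<lambda>x. f (x, y)) has_derivative (\<lambda>a. fderiv f (x, y) (a, 0))) (at x)"
    by (rule has_derivative_compose[where f = "\<lambda>x. (x, y)", OF _ f])
       (auto intro!: derivative_eq_intros)
  from fderivI[OF this] show ?thesis by simp
qed

lemma fderiv_partial_snd:
  assumes "f differentiable (at (x, y))"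
  shows "fderiv (\<lambda>y. f (x, y)) y a = fderiv f (x, y) (0, a)"
proof -
  have f: "(f has_derivative fderiv f (x, y)) (at (x, y))"
    using assms frechet_derivative_works by blast
  have "((\<lambda>y. f (x, y)) has_derivative (\<lambda>a. fderiv f (x, y) (0, a))) (at y)"
    by (rule has_derivative_compose[where f = "\<lambda>y. (x, y)", OF _ f])
       (auto intro!: derivative_eq_intros)
  from fderivI[OF this] show ?thesis by simp
qed

lemma differentiable_vec_nth: "f differentiable F \<Longrightarrow> (\<lambda>z. f z $ i) differentiable F"
  unfolding differentiable_def using bounded_linear.has_derivative[OF bounded_linear_vec_nth] by blast

lemma fderiv_vec_nth:
  assumes "f differentiable (at x)"
  shows "fderiv (\<lambda>z. f z $ i) x v = fderiv f x v $ i"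
proof -
  have "((\<lambda>z. f z $ i) has_derivative (\<lambda>v. fderiv f x v $ i)) (at x)"
    by (rule bounded_linear.has_derivative[OF bounded_linear_vec_nth])
       (use assms frechet_derivative_works in blast)
  from fderivI[OF this] show ?thesis by simp
qed

lemma linear_eq_sum_axis:
  fixes L :: "real^'n::finite \<Rightarrow> 'b::real_vector"
  assumes "linear L"
  shows "L v = (\<Sum>k\<in>UNIV. v $ k *\<^sub>R L (axis k 1))"
proof -
  have "L v = L (\<Sum>k\<in>UNIV. v $ k *\<^sub>R axis k 1)"
    by (simp add: scalar_mult_eq_scaleR[symmetric] basis_expansion)
  thus ?thesis using assms by (simp add: linear_sum linear_cmul)
qed

text \<open>Contraction of a repeated index against the values of a linear map at the
  \<open>axis\<close> vectors is evaluation of the map. Most index sums in the coefficients are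
  removed this way.\<close>

lemma linear_eq_sum_axis_nth:
  fixes L :: "real^'n::finite \<Rightarrow> real^'m::finite"
  assumes "linear L"
  shows "(\<Sum>k\<in>UNIV. v $ k * L (axis k 1) $ i) = L v $ i"
  by (subst linear_eq_sum_axis[OF assms]) simp

lemma linear_Pair_0:
  assumes "linear L"
  shows "linear (\<lambda>a. L (a, 0))" "linear (\<lambda>a. L (0, a))"
proof -
  interpret linear L by fact
  show "linear (\<lambda>a. L (a, 0))" "linear (\<lambda>a. L (0, a))"
    by (auto intro!: linearI simp: add[symmetric] scale[symmetric])
qed

section \<open>Partial derivatives of \<open>F\<close>, \<open>G\<close> and \<open>Mcoef\<close> in
  one chart as total derivatives\<close>

locale spray_chart =
  fixes U :: "(real^'n::finite) set" and G F :: "'n loc"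
  assumes open_U: "open U"
    and smooth_G: "smooth_on (\<lambda>(x, y). G x y) (U \<times> (- {0}))"
    and smooth_F: "smooth_on (\<lambda>(x, y). F x y) (U \<times> (- {0}))"
    and euler_Mcoef: "x \<in> U \<Longrightarrow> y \<noteq> 0 \<Longrightarrow>
      2 * G x y $ i = (\<Sum>j\<in>UNIV. Mcoef G i j x y * y $ j)"
begin

abbreviation g :: "(real^'n) \<times> (real^'n) \<Rightarrow> real^'n" where "g \<equiv> \<lambda>(x, y). G x y"
abbreviation f :: "(real^'n) \<times> (real^'n) \<Rightarrow> real^'n" where "f \<equiv> \<lambda>(x, y). F x y"

text \<open>Along a curve, \<open>sode\<close> is \<open>x'' + 2 G (x, x') - F (x, x')\<close>.\<close>

definition sode :: "'n T2 \<Rightarrow> real^'n" where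
  "sode = (\<lambda>(x, y, z). 2 *\<^sub>R z + 2 *\<^sub>R G x y - F x y)"

lemma open_slit: "open (U \<times> (- {0::real^'n}))"
  by (intro open_Times open_U open_Compl closed_singleton)

lemma pdx_F: "x \<in> U \<Longrightarrow> y \<noteq> 0 \<Longrightarrow> pdx j (\<lambda>x y. F x y $ i) x y = fderiv f (x, y) (axis j 1, 0) $ i"
  using fderiv_partial_fst[of "\<lambda>p. f p $ i" x y "axis j 1"] fderiv_vec_nth[of f "(x, y)" i]
    smooth_on_differentiable[OF smooth_F, of "(x, y)"]
  by (simp add: pdx_def differentiable_vec_nth)

lemma pdy_F: "x \<in> U \<Longrightarrow> y \<noteq> 0 \<Longrightarrow> pdy j (\<lambda>x y. F x y $ i) x y = fderiv f (x, y) (0, axis j 1) $ i"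
  using fderiv_partial_snd[of "\<lambda>p. f p $ i" x y "axis j 1"] fderiv_vec_nth[of f "(x, y)" i]
    smooth_on_differentiable[OF smooth_F, of "(x, y)"]
  by (simp add: pdy_def differentiable_vec_nth)

lemma Mcoef_eq: "x \<in> U \<Longrightarrow> y \<noteq> 0 \<Longrightarrow> Mcoef G i j x y = fderiv g (x, y) (0, axis j 1) $ i"
  using fderiv_partial_snd[of "\<lambda>p. g p $ i" x y "axis j 1"] fderiv_vec_nth[of g "(x, y)" i]
    smooth_on_differentiable[OF smooth_G, of "(x, y)"]
  by (simp add: pdy_def Mcoef_def differentiable_vec_nth)

lemma pdx_Mcoef:
  assumes "x \<in> U" "y \<noteq> 0"
  shows "pdx k (Mcoef G i j) x y = fderiv2 g (x, y) (0, axis j 1) (axis k 1, 0) $ i"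
proof -
  let ?m = "\<lambda>p. fderiv g p (0, axis j 1)"
  have d: "?m differentiable (at (x, y))"
    by (rule smooth_on_differentiable[OF smooth_on_fderiv[OF smooth_G]]) (use assms in simp)
  have "fderiv (\<lambda>x. Mcoef G i j x y) x = fderiv (\<lambda>x. ?m (x, y) $ i) x"
    by (rule fderiv_cong_open[OF open_U assms(1)]) (rule Mcoef_eq[OF _ assms(2)])
  thus ?thesis
    using fderiv_partial_fst[of "\<lambda>p. ?m p $ i" x y "axis k 1"] fderiv_vec_nth[OF d, of i]
    by (simp add: pdx_def d differentiable_vec_nth)
qed

lemma pdy_Mcoef:
  assumes "x \<in> U" "y \<noteq> 0"
  shows "pdy k (Mcoef G i j) x y = fderiv2 g (x, y) (0, axis j 1) (0, axis k 1) $ i"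
proof -
  let ?m = "\<lambda>p. fderiv g p (0, axis j 1)"
  have d: "?m differentiable (at (x, y))"
    by (rule smooth_on_differentiable[OF smooth_on_fderiv[OF smooth_G]]) (use assms in simp)
  \<comment> \<open>The formula for \<open>Mcoef\<close> is known for \<open>y \<noteq> 0\<close>;
    that set is open, so the formula may be differentiated in \<open>y\<close>.\<close>
  have "fderiv (\<lambda>y. Mcoef G i j x y) y = fderiv (\<lambda>y. ?m (x, y) $ i) y"
    by (rule fderiv_cong_open[of "- {0}"]) (use assms Mcoef_eq[OF assms(1)] in auto)
  thus ?thesis
    using fderiv_partial_snd[of "\<lambda>p. ?m p $ i" x y "axis k 1"] fderiv_vec_nth[OF d, of i]
    by (simp add: pdy_def d differentiable_vec_nth)
qed

lemma linear_fderiv_g: "x \<in> U \<Longrightarrow> y \<noteq> 0 \<Longrightarrow> linear (fderiv g (x, y))"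
  by (rule smooth_on_linear_fderiv[OF smooth_G]) simp

lemma linear_fderiv_f: "x \<in> U \<Longrightarrow> y \<noteq> 0 \<Longrightarrow> linear (fderiv f (x, y))"
  by (rule smooth_on_linear_fderiv[OF smooth_F]) simp

lemma linear_fderiv2_g: "x \<in> U \<Longrightarrow> y \<noteq> 0 \<Longrightarrow> linear (fderiv2 g (x, y) a)"
  by (rule smooth_on_linear_fderiv[OF smooth_on_fderiv[OF smooth_G]]) simp

lemma fderiv2_g_symmetric: "x \<in> U \<Longrightarrow> y \<noteq> 0 \<Longrightarrow> fderiv2 g (x, y) a b = fderiv2 g (x, y) b a"
  by (rule fderiv2_symmetric[OF smooth_G]) simp

section \<open>Euler's relation and the coefficients as linear maps\<close>

lemma euler:
  assumes "x \<in> U" "y \<noteq> 0"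
  shows "fderiv g (x, y) (0, y) = 2 *\<^sub>R G x y"
proof (rule vec_eq_iff[THEN iffD2, rule_format])
  fix i
  have "(2 *\<^sub>R G x y) $ i = (\<Sum>j\<in>UNIV. y $ j * fderiv g (x, y) (0, axis j 1) $ i)"
    using euler_Mcoef[OF assms] by (simp add: Mcoef_eq[OF assms] mult.commute)
  also have "\<dots> = fderiv g (x, y) (0, y) $ i"
    by (rule linear_eq_sum_axis_nth[OF linear_Pair_0(2)[OF linear_fderiv_g[OF assms]]])
  finally show "fderiv g (x, y) (0, y) $ i = (2 *\<^sub>R G x y) $ i" by simp
qed

text \<open>Euler's relation is differentiated along \<open>(X, Y)\<close>. On its left side
  \<open>y\<close> occurs both in the base point and as the vector, hence two terms. The case
  \<open>X = 0\<close> expresses that \<open>M\<close> is 1-homogeneous in \<open>y\<close>; the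
  case \<open>Y = 0\<close> evaluates the mixed derivatives contracted with
  \<open>y\<close>.\<close>

lemma euler_deriv:
  assumes "x \<in> U" "y \<noteq> 0"
  shows "fderiv2 g (x, y) (0, y) (X, Y) + fderiv g (x, y) (0, Y) = 2 *\<^sub>R fderiv g (x, y) (X, Y)"
proof -
  let ?S = "U \<times> (- {0::real^'n})"
  have p: "(x, y) \<in> ?S" using assms by simp
  \<comment> \<open>The left side of Euler's relation is the evaluation map of the derivative
    composed with \<open>q \<mapsto> (q, (0, snd q))\<close>.\<close>
  have 1: "((\<lambda>q. (\<lambda>(x, y). fderiv g x y) (q, (0, snd q))) has_derivative
      (\<lambda>V. (\<lambda>(X, Y). fderiv2 g (x, y) (0, y) X + fderiv g (x, y) Y) (V, (0, snd V)))) (at (x, y))"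
  proof (rule has_derivative_compose[where g = "\<lambda>(x, y). fderiv g x y"
        and g' = "\<lambda>(X, Y). fderiv2 g (x, y) (0, y) X + fderiv g (x, y) Y"])
    show "((\<lambda>q. (q, (0::real^'n, snd q))) has_derivative (\<lambda>V. (V, (0, snd V)))) (at (x, y))"
      by (auto intro!: derivative_eq_intros)
    show "((\<lambda>(x, y). fderiv g x y) has_derivative
        (\<lambda>(X, Y). fderiv2 g (x, y) (0, y) X + fderiv g (x, y) Y)) (at ((x, y), 0, snd (x, y)))"
      using fderiv_apply_has_derivative[OF smooth_G p, of "(0, y)"] by simp
  qed
  have "((\<lambda>q. 2 *\<^sub>R g q) has_derivative
      (\<lambda>V. fderiv2 g (x, y) (0, y) V + fderiv g (x, y) (0, snd V))) (at (x, y))"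
    using has_derivative_transform_within_open[OF 1 open_slit p, of "\<lambda>q. 2 *\<^sub>R g q"] euler by auto
  moreover have "((\<lambda>q. 2 *\<^sub>R g q) has_derivative (\<lambda>V. 2 *\<^sub>R fderiv g (x, y) V)) (at (x, y))"
    by (rule has_derivative_scaleR_right[OF smooth_on_has_derivative[OF smooth_G p]])
  ultimately show ?thesis
    using has_derivative_unique by (smt (verit, best) snd_conv)
qed

lemma M1_mult:
  assumes xy: "x \<in> U" "y \<noteq> 0"
  shows "M1 G F (x, y, z) *v X = fderiv g (x, y) (0, X) - (1/2) *\<^sub>R fderiv f (x, y) (0, X)"
proof -
  let ?L = "\<lambda>X. fderiv g (x, y) (0, X) - (1/2) *\<^sub>R fderiv f (x, y) (0, X)"
  have "linear ?L"
    by (intro linear_compose_sub linear_compose_scale_right linear_Pair_0 linear_fderiv_g linear_fderiv_f xy)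
  moreover have "M1 G F (x, y, z) = matrix ?L"
    by (simp add: M1_def matrix_def vec_eq_iff pdy_F[OF xy] Mcoef_eq[OF xy] algebra_simps)
  ultimately show ?thesis by (simp add: matrix_works)
qed

text \<open>The two halves of \<open>Rcoef\<close> react differently to contraction with
  \<open>y\<close>: in the first, \<open>y\<close> meets the direction of differentiation; in the
  second, it meets the lower index of \<open>M\<close>, where Euler's relation evaluates it. The
  product of the \<open>Mcoef\<close> that results is the one that cancels in
  \<open>M2\<close>.\<close>

lemma Rcoef_contract:
  assumes xy: "x \<in> U" "y \<noteq> 0"
  shows "(\<Sum>k\<in>UNIV. y $ k * Rcoef G i j k x y) =
    fderiv2 g (x, y) (0, axis j 1) (y, 0) $ i - 2 * fderiv2 g (x, y) (0, axis j 1) (0, G x y) $ i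
    - 2 * fderiv g (x, y) (axis j 1, 0) $ i + (\<Sum>l\<in>UNIV. Mcoef G i l x y * Mcoef G l j x y)"
proof -
  let ?L = "fderiv2 g (x, y) (0, axis j 1)"
  note lin = linear_Pair_0[OF linear_fderiv2_g[OF xy]]
  \<comment> \<open>Contracted with \<open>y\<close>, the operator \<open>delta\<close> is
    differentiation along \<open>(y, - 2 G)\<close>, because \<open>Mcoef G l k\<close> contracted
    with \<open>y\<close> in \<open>k\<close> is \<open>2 G\<close>.\<close>
  have 1: "(\<Sum>k\<in>UNIV. y $ k * delta G k (Mcoef G i j) x y) = ?L (y, 0) $ i - 2 * ?L (0, G x y) $ i"
  proof -
    have "(\<Sum>k\<in>UNIV. y $ k * (\<Sum>l\<in>UNIV. Mcoef G l k x y * ?L (0, axis l 1) $ i))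
        = (\<Sum>l\<in>UNIV. (\<Sum>k\<in>UNIV. Mcoef G l k x y * y $ k) * ?L (0, axis l 1) $ i)"
      unfolding sum_distrib_left sum_distrib_right by (subst sum.swap) (simp add: ac_simps)
    also have "\<dots> = 2 * (\<Sum>l\<in>UNIV. G x y $ l * ?L (0, axis l 1) $ i)"
      by (simp add: euler_Mcoef[OF xy, symmetric] sum_distrib_left mult.assoc)
    also have "\<dots> = 2 * ?L (0, G x y) $ i" by (simp add: linear_eq_sum_axis_nth[OF lin(2)])
    finally show ?thesis
      by (simp add: delta_def pdx_Mcoef[OF xy] pdy_Mcoef[OF xy] right_diff_distrib sum_subtractf
          linear_eq_sum_axis_nth[OF lin(1)])
  qed
  \<comment> \<open>The contracted index sits in the first vector of \<open>fderiv2\<close>;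
    symmetry moves it to the second, where linearity is that of a derivative.\<close>
  have c: "(\<Sum>k\<in>UNIV. y $ k * fderiv2 g (x, y) (0, axis k 1) w $ i) = fderiv2 g (x, y) (0, y) w $ i" for w
    unfolding fderiv2_g_symmetric[OF xy, of _ w] by (rule linear_eq_sum_axis_nth[OF lin(2)])
  have 2: "(\<Sum>k\<in>UNIV. y $ k * delta G j (Mcoef G i k) x y)
      = 2 * fderiv g (x, y) (axis j 1, 0) $ i - (\<Sum>l\<in>UNIV. Mcoef G i l x y * Mcoef G l j x y)"
  proof -
    have "fderiv2 g (x, y) (0, y) (axis j 1, 0) = 2 *\<^sub>R fderiv g (x, y) (axis j 1, 0)"
      using euler_deriv[OF xy, of "axis j 1" 0] linear_0[OF linear_fderiv_g[OF xy]] by (simp add: zero_prod_def)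
    moreover have "fderiv2 g (x, y) (0, y) (0, axis l 1) = fderiv g (x, y) (0, axis l 1)" for l
      using euler_deriv[OF xy, of 0 "axis l 1"] by (simp add: scaleR_2)
    moreover have "(\<Sum>k\<in>UNIV. y $ k * (\<Sum>l\<in>UNIV. Mcoef G l j x y * fderiv2 g (x, y) (0, axis k 1) (0, axis l 1) $ i))
        = (\<Sum>l\<in>UNIV. Mcoef G l j x y * fderiv2 g (x, y) (0, y) (0, axis l 1) $ i)"
      unfolding c[symmetric] sum_distrib_left by (subst sum.swap) (simp add: ac_simps)
    ultimately show ?thesis
      by (simp add: delta_def pdx_Mcoef[OF xy] pdy_Mcoef[OF xy] right_diff_distrib sum_subtractf c
          Mcoef_eq[OF xy, of i] mult.commute)
  qed
  show ?thesis
    unfolding Rcoef_def right_diff_distrib sum_subtractf 1 2 by simp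
qed

text \<open>The derivative of \<open>Mcoef\<close> along \<open>(y, 0)\<close> in \<open>CC\<close>
  cancels against the contracted curvature, and so do the products of \<open>Mcoef\<close>. The
  second derivatives that remain form the fibre Hessian of \<open>G\<close> with one argument
  \<open>2 z + 2 G - F\<close>, which is \<open>sode\<close>.\<close>

lemma M2_mult:
  assumes xy: "x \<in> U" "y \<noteq> 0"
  shows "M2 G F (x, y, z) *v X = fderiv g (x, y) (X, 0) - (1/2) *\<^sub>R fderiv f (x, y) (X, 0)
    + (1/2) *\<^sub>R fderiv2 g (x, y) (0, sode (x, y, z)) (0, X)"
proof -
  let ?L = "\<lambda>X. fderiv g (x, y) (X, 0) - (1/2) *\<^sub>R fderiv f (x, y) (X, 0)
    + (1/2) *\<^sub>R fderiv2 g (x, y) (0, sode (x, y, z)) (0, X)"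
  have "linear ?L"
    by (intro linear_compose_sub linear_compose_add linear_compose_scale_right linear_Pair_0 linear_fderiv_g
        linear_fderiv_f linear_fderiv2_g xy)
  moreover have entry: "M2 G F (x, y, z) $ i $ j = matrix ?L $ i $ j" for i j
  proof -
    let ?D = "fderiv2 g (x, y) (0, axis j 1)"
    note lin = linear_Pair_0[OF linear_fderiv2_g[OF xy]]
    interpret D: linear "\<lambda>v. ?D (0, v)" by (rule lin)
    have "CC (Mcoef G i j) x y z = ?D (y, 0) $ i + 2 * ?D (0, z) $ i"
      by (simp add: CC_def pdx_Mcoef[OF xy] pdy_Mcoef[OF xy] sum.distrib mult.assoc
          linear_eq_sum_axis_nth[OF lin(1)] linear_eq_sum_axis_nth[OF lin(2)] flip: sum_distrib_left)
    moreover have "(\<Sum>k\<in>UNIV. pdy j (Mcoef G i k) x y * F x y $ k) = ?D (0, F x y) $ i"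
      using linear_eq_sum_axis_nth[OF lin(2), of "F x y" "(0, axis j 1)" i]
      by (simp add: pdy_Mcoef[OF xy] fderiv2_g_symmetric[OF xy, of _ "(0, axis j 1)"] mult.commute)
    moreover have "fderiv2 g (x, y) (0, sode (x, y, z)) (0, axis j 1) $ i
        = 2 * ?D (0, z) $ i + 2 * ?D (0, G x y) $ i - ?D (0, F x y) $ i"
      unfolding fderiv2_g_symmetric[OF xy, of _ "(0, axis j 1)"] sode_def
      by (simp add: D.add D.diff D.scale)
    ultimately show ?thesis
      by (simp add: M2_def matrix_def Rcoef_contract[OF xy] pdx_F[OF xy] field_simps)
  qed
  moreover have "M2 G F (x, y, z) = matrix ?L"
    unfolding vec_eq_iff using entry by blast
  ultimately show ?thesis by (simp add: matrix_works)
qed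

section \<open>The forms \<open>delta_y1\<close> and \<open>delta_y2\<close> in terms of
  \<open>sode\<close>\<close>

lemma sode_has_derivative:
  assumes xy: "x \<in> U" "y \<noteq> 0"
  shows "(sode has_derivative (\<lambda>(X, Y, Z). 2 *\<^sub>R Z + 2 *\<^sub>R fderiv g (x, y) (X, Y) - fderiv f (x, y) (X, Y)))
    (at (x, y, z))"
proof -
  let ?\<pi> = "\<lambda>p :: 'n T2. (fst p, fst (snd p))"
  have pi: "(?\<pi> has_derivative ?\<pi>) (at (x, y, z))"
    by (auto intro!: derivative_eq_intros)
  have "((\<lambda>p. g (?\<pi> p)) has_derivative (\<lambda>V. fderiv g (x, y) (?\<pi> V))) (at (x, y, z))"
    by (rule has_derivative_compose[where f = ?\<pi>, OF pi])
       (use smooth_on_has_derivative[OF smooth_G] xy in simp)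
  moreover have "((\<lambda>p. f (?\<pi> p)) has_derivative (\<lambda>V. fderiv f (x, y) (?\<pi> V))) (at (x, y, z))"
    by (rule has_derivative_compose[where f = ?\<pi>, OF pi])
       (use smooth_on_has_derivative[OF smooth_F] xy in simp)
  ultimately have "((\<lambda>p. 2 *\<^sub>R snd (snd p) + 2 *\<^sub>R g (?\<pi> p) - f (?\<pi> p)) has_derivative
      (\<lambda>V. 2 *\<^sub>R snd (snd V) + 2 *\<^sub>R fderiv g (x, y) (?\<pi> V) - fderiv f (x, y) (?\<pi> V))) (at (x, y, z))"
    by (auto intro!: derivative_eq_intros)
  thus ?thesis by (simp add: sode_def case_prod_unfold)
qed

lemma delta_y1_eq:
  assumes xy: "x \<in> U" "y \<noteq> 0"
  shows "delta_y1 (M1 G F) (x, y, z) (X, Y, Z) = Y + fderiv g (x, y) (0, X) - (1/2) *\<^sub>R fderiv f (x, y) (0, X)"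
  by (simp add: delta_y1_def M1_mult[OF xy])

text \<open>Apart from the Hessian term, \<open>M1\<close> applied to \<open>Y\<close> and
  \<open>M2\<close> applied to \<open>X\<close> supply the fibre and base parts of the derivative of
  \<open>2 G - F\<close>; twice their sum, together with \<open>2 Z\<close>, is the derivative of
  \<open>sode\<close>.\<close>

lemma delta_y2_eq:
  assumes xy: "x \<in> U" "y \<noteq> 0"
  shows "2 *\<^sub>R delta_y2 (M1 G F) (M2 G F) (x, y, z) (X, Y, Z) =
    fderiv sode (x, y, z) (X, Y, Z) + fderiv2 g (x, y) (0, sode (x, y, z)) (0, X)"
proof -
  have "h (X, Y) = h (X, 0) + h (0, Y)" if "linear h" for h :: "(real^'n) \<times> (real^'n) \<Rightarrow> real^'n"
    using linear_add[OF that, of "(X, 0)" "(0, Y)"] by simp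
  note split = this[OF linear_fderiv_g[OF xy]] this[OF linear_fderiv_f[OF xy]]
  show ?thesis
    by (simp add: delta_y2_def M1_mult[OF xy] M2_mult[OF xy] fderivI[OF sode_has_derivative[OF xy]] split
        algebra_simps)
qed

end


section \<open>Changes of coordinates\<close>

lemma vel_eqI: "(x has_vector_derivative v) (at t) \<Longrightarrow> vel x t = v"
  by (simp add: vel_def vector_derivative_at)

lemma vel_cong_open:
  assumes "open S" "t \<in> S" "\<And>s. s \<in> S \<Longrightarrow> x s = z s"
  shows "vel x t = vel z t"
proof -
  have "(x has_vector_derivative d) (at t) \<longleftrightarrow> (z has_vector_derivative d) (at t)" for d
    using has_vector_derivative_transform_within_open[OF _ assms(1,2)] assms(3) by metis
  thus ?thesis by (simp add: vel_def vector_derivative_def)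
qed

lemma has_derivative_chain_curve:
  assumes "(x has_vector_derivative v) (at t)" "(f has_derivative f') (at (x t))"
  shows "((\<lambda>t. f (x t)) has_vector_derivative f' v) (at t)"
  using vector_derivative_diff_chain_within[OF assms(1) has_derivative_at_withinI[OF assms(2)]]
  by (simp add: o_def)

text \<open>The chain rule is used twice along the representing curve \<open>\<gamma>\<close>, whose
  first two derivatives at 0 are \<open>y\<close> and \<open>2 z\<close>. The factor 1/2 in
  \<open>extension\<close> then leaves \<open>z\<close> with coefficient 1 and the quadratic term
  with coefficient 1/2.\<close>

lemma T2_map_eq:
  fixes \<tau> :: "real^'n::finite \<Rightarrow> real^'n"
  assumes \<tau>: "smooth_on \<tau> W" and x: "x \<in> W"
  shows "T2_map \<tau> (x, y, z) = (\<tau> x, fderiv \<tau> x y, (1/2) *\<^sub>R fderiv2 \<tau> x y y + fderiv \<tau> x z)"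
proof -
  define \<gamma> where "\<gamma> = (\<lambda>t::real. x + t *\<^sub>R y + t\<^sup>2 *\<^sub>R z)"
  have \<gamma>': "(\<gamma> has_vector_derivative (y + (2 * t) *\<^sub>R z)) (at t)" for t
    unfolding \<gamma>_def by (auto intro!: derivative_eq_intros)
  \<comment> \<open>The velocity of the image curve is computed while \<open>\<gamma>\<close> stays
    in \<open>W\<close>; these times form an open set around 0, which permits a second
    differentiation there.\<close>
  have N: "open (\<gamma> -` W)"
    by (rule open_vimage[OF smooth_on_open[OF \<tau>]]) (auto simp: \<gamma>_def intro!: continuous_intros)
  have 0: "0 \<in> \<gamma> -` W" by (simp add: \<gamma>_def x)
  have 1: "vel (\<lambda>t. \<tau> (\<gamma> t)) t = fderiv \<tau> (\<gamma> t) (y + (2 * t) *\<^sub>R z)" if "t \<in> \<gamma> -` W" for t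
    by (rule vel_eqI[OF has_derivative_chain_curve[OF \<gamma>' smooth_on_has_derivative[OF \<tau>]]]) (use that in simp)
  have "((\<lambda>t. (\<gamma> t, y + (2 * t) *\<^sub>R z)) has_vector_derivative (y, 2 *\<^sub>R z)) (at 0)"
    using \<gamma>'[of 0] by (auto intro!: has_vector_derivative_Pair derivative_eq_intros)
  moreover have "((\<lambda>(x, y). fderiv \<tau> x y) has_derivative
      (\<lambda>(X, Y). fderiv2 \<tau> x y X + fderiv \<tau> x Y)) (at (\<gamma> 0, y + (2 * 0) *\<^sub>R z))"
    using fderiv_apply_has_derivative[OF \<tau> x, of y] by (simp add: \<gamma>_def)
  ultimately have "((\<lambda>t. fderiv \<tau> (\<gamma> t) (y + (2 * t) *\<^sub>R z)) has_vector_derivative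
      (fderiv2 \<tau> x y y + fderiv \<tau> x (2 *\<^sub>R z))) (at 0)"
    by (auto dest: has_derivative_chain_curve)
  hence "vel (\<lambda>t. fderiv \<tau> (\<gamma> t) (y + (2 * t) *\<^sub>R z)) 0 = fderiv2 \<tau> x y y + 2 *\<^sub>R fderiv \<tau> x z"
    using smooth_on_linear_fderiv[OF \<tau> x] by (simp add: vel_eqI linear_cmul)
  moreover have "vel (vel (\<lambda>t. \<tau> (\<gamma> t))) 0 = vel (\<lambda>t. fderiv \<tau> (\<gamma> t) (y + (2 * t) *\<^sub>R z)) 0"
    by (rule vel_cong_open[OF N 0 1])
  moreover have "T2_map \<tau> (x, y, z) = extension (\<lambda>t. \<tau> (\<gamma> t)) 0"
    by (simp add: T2_map_def \<gamma>_def)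
  ultimately show ?thesis
    using 1[OF 0] by (simp add: extension_def \<gamma>_def algebra_simps)
qed

text \<open>Linearity in the direction \<open>w\<close> is that of a derivative; linearity in
  \<open>v\<close> follows from it by symmetry.\<close>

lemma fderiv2_expand:
  fixes f :: "'a::euclidean_space \<Rightarrow> 'b::euclidean_space"
  assumes f: "smooth_on f S" and x: "x \<in> S"
  shows "fderiv2 f x v w = (\<Sum>b\<in>Basis. (v \<bullet> b) *\<^sub>R fderiv2 f x b w)"
proof -
  have "fderiv2 f x v w = fderiv2 f x w (\<Sum>b\<in>Basis. (v \<bullet> b) *\<^sub>R b)"
    by (simp add: euclidean_representation fderiv2_symmetric[OF f x, of v])
  also have "\<dots> = (\<Sum>b\<in>Basis. (v \<bullet> b) *\<^sub>R fderiv2 f x w b)"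
    using smooth_on_linear_fderiv[OF smooth_on_fderiv[OF f] x] by (simp add: linear_sum linear_cmul)
  also have "\<dots> = (\<Sum>b\<in>Basis. (v \<bullet> b) *\<^sub>R fderiv2 f x b w)"
    by (simp add: fderiv2_symmetric[OF f x, of w])
  finally show ?thesis .
qed

text \<open>This concerns the quadratic term in the last component of \<open>T2_map\<close>.
  Expanding one of its two equal vectors in \<open>Basis\<close> gives a sum of coordinates times
  maps of the kind treated in \<open>fderiv_apply_has_derivative\<close>.\<close>

lemma fderiv2_diagonal_differentiable:
  fixes f :: "'a::euclidean_space \<Rightarrow> 'b::euclidean_space"
  assumes f: "smooth_on f S" and x: "x \<in> S"
  shows "(\<lambda>(x, y). fderiv2 f x y y) differentiable (at (x, y))"
proof -
  have S: "open (S \<times> (UNIV::'a set))" using smooth_on_open[OF f] by (intro open_Times) auto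
  have "(\<lambda>(x, y). fderiv2 f x b y) differentiable (at (x, y))" for b
    using fderiv_apply_has_derivative[OF smooth_on_fderiv[OF f] x] unfolding differentiable_def by blast
  moreover have coord: "(\<lambda>p. snd p \<bullet> b) differentiable (at (x, y))" for b :: 'a
    by (rule differentiableI[where f' = "\<lambda>p. snd p \<bullet> b"]) (auto intro!: derivative_eq_intros)
  ultimately have "(\<lambda>p. \<Sum>b\<in>Basis. (snd p \<bullet> b) *\<^sub>R (\<lambda>(x, y). fderiv2 f x b y) p) differentiable (at (x, y))"
    by (intro differentiable_sum differentiable_scaleR ballI coord finite_Basis)
  then obtain D where
    "((\<lambda>p. \<Sum>b\<in>Basis. (snd p \<bullet> b) *\<^sub>R (\<lambda>(x, y). fderiv2 f x b y) p) has_derivative D) (at (x, y))"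
    unfolding differentiable_def by blast
  hence "((\<lambda>(x, y). fderiv2 f x y y) has_derivative D) (at (x, y))"
  proof (rule has_derivative_transform_within_open[OF _ S])
    show "(x, y) \<in> S \<times> UNIV" using x by simp
    fix p :: "'a \<times> 'a" assume "p \<in> S \<times> UNIV"
    thus "(\<Sum>b\<in>Basis. (snd p \<bullet> b) *\<^sub>R (\<lambda>(x, y). fderiv2 f x b y) p) = (\<lambda>(x, y). fderiv2 f x y y) p"
      using fderiv2_expand[OF f, of "fst p" "snd p" "snd p"] by (auto simp: case_prod_beta)
  qed
  thus ?thesis unfolding differentiable_def by blast
qed

text \<open>The last component of the derivative is left unspecified: it would involve third derivatives of
  \<open>\<tau>\<close>, and the transformation of the dual coefficients can be read off without it.\<close>

lemma T2_map_has_derivative: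
  fixes \<tau> :: "real^'n::finite \<Rightarrow> real^'n"
  assumes \<tau>: "smooth_on \<tau> W" and x: "x \<in> W"
  obtains K where "(T2_map \<tau> has_derivative
    (\<lambda>(X, Y, Z). (fderiv \<tau> x X, fderiv2 \<tau> x y X + fderiv \<tau> x Y, K (X, Y, Z)))) (at (x, y, z))"
proof -
  have S: "open (W \<times> (UNIV :: ((real^'n) \<times> (real^'n)) set))"
    using smooth_on_open[OF \<tau>] by (intro open_Times) auto
  let ?\<pi> = "\<lambda>p :: 'n T2. (fst p, fst (snd p))" and ?\<rho> = "\<lambda>p :: 'n T2. (fst p, snd (snd p))"
  have pi: "(?\<pi> has_derivative ?\<pi>) (at (x, y, z))" and rho: "(?\<rho> has_derivative ?\<rho>) (at (x, y, z))"
    by (auto intro!: derivative_eq_intros)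
  have 1: "((\<lambda>p. \<tau> (fst p)) has_derivative (\<lambda>V. fderiv \<tau> x (fst V))) (at (x, y, z))"
    by (rule has_derivative_compose[where f = fst])
       (use smooth_on_has_derivative[OF \<tau> x] in \<open>auto intro!: derivative_eq_intros\<close>)
  have 2: "((\<lambda>p. (\<lambda>(x, y). fderiv \<tau> x y) (?\<pi> p)) has_derivative
      (\<lambda>V. (\<lambda>(X, Y). fderiv2 \<tau> x y X + fderiv \<tau> x Y) (?\<pi> V))) (at (x, y, z))"
    by (rule has_derivative_compose[where f = ?\<pi>, OF pi])
       (use fderiv_apply_has_derivative[OF \<tau> x, of y] in simp)
  have 3: "((\<lambda>p. (\<lambda>(x, y). fderiv \<tau> x y) (?\<rho> p)) has_derivative
      (\<lambda>V. (\<lambda>(X, Y). fderiv2 \<tau> x z X + fderiv \<tau> x Y) (?\<rho> V))) (at (x, y, z))"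
    by (rule has_derivative_compose[where f = ?\<rho>, OF rho])
       (use fderiv_apply_has_derivative[OF \<tau> x, of z] in simp)
  obtain D where D: "((\<lambda>(x, y). fderiv2 \<tau> x y y) has_derivative D) (at (x, y))"
    using fderiv2_diagonal_differentiable[OF \<tau> x, of y] unfolding differentiable_def by blast
  have 4: "((\<lambda>p. (\<lambda>(x, y). fderiv2 \<tau> x y y) (?\<pi> p)) has_derivative (\<lambda>V. D (?\<pi> V))) (at (x, y, z))"
    by (rule has_derivative_compose[where f = ?\<pi>, OF pi]) (use D in simp)
  define K where "K = (\<lambda>V. (1/2) *\<^sub>R D (?\<pi> V) + (\<lambda>(X, Y). fderiv2 \<tau> x z X + fderiv \<tau> x Y) (?\<rho> V))"
  have "((\<lambda>p. (\<tau> (fst p), (\<lambda>(x, y). fderiv \<tau> x y) (?\<pi> p),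
       (1/2) *\<^sub>R (\<lambda>(x, y). fderiv2 \<tau> x y y) (?\<pi> p) + (\<lambda>(x, y). fderiv \<tau> x y) (?\<rho> p)))
      has_derivative
      (\<lambda>V. (fderiv \<tau> x (fst V), (\<lambda>(X, Y). fderiv2 \<tau> x y X + fderiv \<tau> x Y) (?\<pi> V), K V))) (at (x, y, z))"
    unfolding K_def by (intro has_derivative_Pair has_derivative_add has_derivative_scaleR_right 1 2 3 4)
  hence "(T2_map \<tau> has_derivative
      (\<lambda>V. (fderiv \<tau> x (fst V), (\<lambda>(X, Y). fderiv2 \<tau> x y X + fderiv \<tau> x Y) (?\<pi> V), K V))) (at (x, y, z))"
  proof (rule has_derivative_transform_within_open[OF _ S])
    show "(x, y, z) \<in> W \<times> UNIV" using x by simp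
    fix p :: "'n T2" assume "p \<in> W \<times> UNIV"
    thus "(\<tau> (fst p), (\<lambda>(x, y). fderiv \<tau> x y) (?\<pi> p),
       (1/2) *\<^sub>R (\<lambda>(x, y). fderiv2 \<tau> x y y) (?\<pi> p) + (\<lambda>(x, y). fderiv \<tau> x y) (?\<rho> p)) = T2_map \<tau> p"
      using T2_map_eq[OF \<tau>, of "fst p" "fst (snd p)" "snd (snd p)"] by auto
  qed
  thus thesis by (intro that[of K]) (simp add: case_prod_unfold)
qed

section \<open>Transformation rules between two charts\<close>

locale spray_chart_change = c1: spray_chart U G F + c2: spray_chart U' G' F'
  for U U' :: "(real^'n::finite) set" and G F G' F' :: "'n loc" +
  fixes W :: "(real^'n) set" and \<tau> :: "real^'n \<Rightarrow> real^'n"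
  assumes smooth_\<tau>: "smooth_on \<tau> W"
    and W_subset: "W \<subseteq> U"
    and \<tau>_image: "x \<in> W \<Longrightarrow> \<tau> x \<in> U'"
    and fderiv_\<tau>_nonzero: "x \<in> W \<Longrightarrow> y \<noteq> 0 \<Longrightarrow> fderiv \<tau> x y \<noteq> 0"
    and G_rule: "x \<in> W \<Longrightarrow> y \<noteq> 0 \<Longrightarrow>
      2 *\<^sub>R G' (\<tau> x) (fderiv \<tau> x y) = fderiv \<tau> x (2 *\<^sub>R G x y) - fderiv2 \<tau> x y y"
    and F_rule: "x \<in> W \<Longrightarrow> y \<noteq> 0 \<Longrightarrow> F' (\<tau> x) (fderiv \<tau> x y) = fderiv \<tau> x (F x y)"
begin

lemma linear_fderiv_\<tau>: "x \<in> W \<Longrightarrow> linear (fderiv \<tau> x)"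
  by (rule smooth_on_linear_fderiv[OF smooth_\<tau>])

lemma linear_fderiv2_\<tau>: "x \<in> W \<Longrightarrow> linear (fderiv2 \<tau> x a)"
  by (rule smooth_on_linear_fderiv[OF smooth_on_fderiv[OF smooth_\<tau>]])

lemma fderiv2_\<tau>_symmetric: "x \<in> W \<Longrightarrow> fderiv2 \<tau> x a b = fderiv2 \<tau> x b a"
  by (rule fderiv2_symmetric[OF smooth_\<tau>])

text \<open>The term \<open>fderiv2 \<tau> x y y\<close> produced by doubling the last component of
  \<open>T2_map\<close> is removed by the inhomogeneous term in the rule for
  \<open>G\<close>.\<close>

lemma sode_rule:
  assumes "x \<in> W" "y \<noteq> 0"
  shows "c2.sode (T2_map \<tau> (x, y, z)) = fderiv \<tau> x (c1.sode (x, y, z))"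
proof -
  interpret D: linear "fderiv \<tau> x" by (rule linear_fderiv_\<tau>[OF assms(1)])
  show ?thesis
    using G_rule[OF assms] F_rule[OF assms]
    by (simp add: T2_map_eq[OF smooth_\<tau> assms(1)] c1.sode_def c2.sode_def D.add D.diff D.scale algebra_simps)
qed

text \<open>\<open>sode_rule\<close> is differentiated as an identity between functions of
  \<open>(x, y, z)\<close>, so the derivative of \<open>T2_map\<close> enters through the chain rule
  and its last component is never computed. The term with \<open>fderiv2 \<tau>\<close> stems from
  the dependence of \<open>fderiv \<tau> x\<close> on \<open>x\<close>.\<close>

lemma fderiv_sode_rule:
  assumes x: "x \<in> W" and y: "y \<noteq> 0"
  shows "fderiv c2.sode (T2_map \<tau> (x, y, z)) (fderiv (T2_map \<tau>) (x, y, z) (X, Y, Z)) =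
    fderiv2 \<tau> x (c1.sode (x, y, z)) X + fderiv \<tau> x (fderiv c1.sode (x, y, z) (X, Y, Z))"
proof -
  let ?S = "W \<times> (- {0::real^'n}) \<times> (UNIV :: (real^'n) set)"
  have S: "open ?S"
    by (intro open_Times open_UNIV open_Compl closed_singleton smooth_on_open[OF smooth_\<tau>])
  have p: "(x, y, z) \<in> ?S" using x y by simp
  have "x \<in> U" using x W_subset by blast
  obtain K where "(T2_map \<tau> has_derivative
    (\<lambda>(X, Y, Z). (fderiv \<tau> x X, fderiv2 \<tau> x y X + fderiv \<tau> x Y, K (X, Y, Z)))) (at (x, y, z))"
    by (rule T2_map_has_derivative[OF smooth_\<tau> x])
  hence T: "(T2_map \<tau> has_derivative fderiv (T2_map \<tau>) (x, y, z)) (at (x, y, z))"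
    by (rule has_derivative_fderiv)
  have "(c2.sode has_derivative fderiv c2.sode (T2_map \<tau> (x, y, z))) (at (T2_map \<tau> (x, y, z)))"
    unfolding T2_map_eq[OF smooth_\<tau> x]
    by (rule has_derivative_fderiv[OF c2.sode_has_derivative[OF \<tau>_image[OF x] fderiv_\<tau>_nonzero[OF x y]]])
  hence l: "((\<lambda>p. c2.sode (T2_map \<tau> p)) has_derivative
      (\<lambda>V. fderiv c2.sode (T2_map \<tau> (x, y, z)) (fderiv (T2_map \<tau>) (x, y, z) V))) (at (x, y, z))"
    by (rule has_derivative_compose[OF T])
  have s: "(c1.sode has_derivative fderiv c1.sode (x, y, z)) (at (x, y, z))"
    by (rule has_derivative_fderiv[OF c1.sode_has_derivative[OF \<open>x \<in> U\<close> y]])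
  have "((\<lambda>p. (\<lambda>(x, y). fderiv \<tau> x y) (fst p, c1.sode p)) has_derivative
      (\<lambda>V. (\<lambda>(X, Y). fderiv2 \<tau> x (c1.sode (x, y, z)) X + fderiv \<tau> x Y) (fst V, fderiv c1.sode (x, y, z) V)))
      (at (x, y, z))"
    by (rule has_derivative_compose[where f = "\<lambda>p. (fst p, c1.sode p)",
          OF has_derivative_Pair[OF has_derivative_fst[OF has_derivative_ident] s]])
       (use fderiv_apply_has_derivative[OF smooth_\<tau> x] in simp)
  hence "((\<lambda>p. c2.sode (T2_map \<tau> p)) has_derivative
      (\<lambda>V. (\<lambda>(X, Y). fderiv2 \<tau> x (c1.sode (x, y, z)) X + fderiv \<tau> x Y) (fst V, fderiv c1.sode (x, y, z) V)))
      (at (x, y, z))"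
    by (rule has_derivative_transform_within_open[OF _ S p]) (use sode_rule in force)
  from fun_cong[OF has_derivative_unique[OF l this], of "(X, Y, Z)"] show ?thesis by simp
qed

text \<open>The rule for \<open>G\<close> is differentiated in \<open>y\<close> at fixed
  \<open>x\<close>, where \<open>fderiv \<tau> x\<close> is a constant linear map. The quadratic
  term yields twice the bilinear form, and the common factor 2 is divided out.\<close>

lemma fderiv_g_rule:
  assumes x: "x \<in> W" and y: "y \<noteq> 0"
  shows "fderiv c2.g (\<tau> x, fderiv \<tau> x y) (0, fderiv \<tau> x a) =
    fderiv \<tau> x (fderiv c1.g (x, y) (0, a)) - fderiv2 \<tau> x y a"
proof -
  have "x \<in> U" using x W_subset by blast
  interpret D: bounded_linear "fderiv \<tau> x"
    using linear_fderiv_\<tau>[OF x] linear_conv_bounded_linear by blast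
  have "((\<lambda>y. c2.g (\<tau> x, fderiv \<tau> x y)) has_derivative
      (\<lambda>a. fderiv c2.g (\<tau> x, fderiv \<tau> x y) (0, fderiv \<tau> x a))) (at y)"
    by (rule has_derivative_compose[where f = "\<lambda>y. (\<tau> x, fderiv \<tau> x y)"])
       (use smooth_on_has_derivative[OF c2.smooth_G] \<tau>_image[OF x] fderiv_\<tau>_nonzero[OF x y] in
         \<open>auto intro!: derivative_eq_intros D.has_derivative\<close>)
  hence l: "((\<lambda>y. 2 *\<^sub>R c2.g (\<tau> x, fderiv \<tau> x y)) has_derivative
      (\<lambda>a. 2 *\<^sub>R fderiv c2.g (\<tau> x, fderiv \<tau> x y) (0, fderiv \<tau> x a))) (at y)"
    by (rule has_derivative_scaleR_right)
  have "((\<lambda>y. c1.g (x, y)) has_derivative (\<lambda>a. fderiv c1.g (x, y) (0, a))) (at y)"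
    by (rule has_derivative_compose[where f = "\<lambda>y. (x, y)"])
       (use smooth_on_has_derivative[OF c1.smooth_G] \<open>x \<in> U\<close> y in \<open>auto intro!: derivative_eq_intros\<close>)
  moreover have "((\<lambda>y. fderiv2 \<tau> x y y) has_derivative (\<lambda>a. 2 *\<^sub>R fderiv2 \<tau> x y a)) (at y)"
  proof -
    have "bounded_bilinear (\<lambda>v w. fderiv2 \<tau> x v w)"
      unfolding bilinear_conv_bounded_bilinear[symmetric] bilinear_def
      using linear_fderiv2_\<tau>[OF x] fderiv2_\<tau>_symmetric[OF x] by presburger
    from bounded_bilinear.FDERIV[OF this has_derivative_ident has_derivative_ident, of y UNIV]
    show ?thesis
      by (rule has_derivative_eq_rhs) (simp add: fun_eq_iff scaleR_2 fderiv2_\<tau>_symmetric[OF x, of _ y])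
  qed
  ultimately have "((\<lambda>y. fderiv \<tau> x (2 *\<^sub>R c1.g (x, y)) - fderiv2 \<tau> x y y) has_derivative
      (\<lambda>a. fderiv \<tau> x (2 *\<^sub>R fderiv c1.g (x, y) (0, a)) - 2 *\<^sub>R fderiv2 \<tau> x y a)) (at y)"
    by (intro has_derivative_diff D.has_derivative has_derivative_scaleR_right)
  hence "((\<lambda>y. 2 *\<^sub>R c2.g (\<tau> x, fderiv \<tau> x y)) has_derivative
      (\<lambda>a. fderiv \<tau> x (2 *\<^sub>R fderiv c1.g (x, y) (0, a)) - 2 *\<^sub>R fderiv2 \<tau> x y a)) (at y)"
    by (rule has_derivative_transform_within_open[of _ _ _ _ "- {0}"]) (use y in \<open>auto simp: G_rule[OF x]\<close>)
  from fun_cong[OF has_derivative_unique[OF l this], of a]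
  have "2 *\<^sub>R fderiv c2.g (\<tau> x, fderiv \<tau> x y) (0, fderiv \<tau> x a) =
    2 *\<^sub>R (fderiv \<tau> x (fderiv c1.g (x, y) (0, a)) - fderiv2 \<tau> x y a)"
    by (simp add: D.scaleR algebra_simps)
  thus ?thesis by simp
qed

lemma fderiv_f_rule:
  assumes x: "x \<in> W" and y: "y \<noteq> 0"
  shows "fderiv c2.f (\<tau> x, fderiv \<tau> x y) (0, fderiv \<tau> x a) = fderiv \<tau> x (fderiv c1.f (x, y) (0, a))"
proof -
  have "x \<in> U" using x W_subset by blast
  interpret D: bounded_linear "fderiv \<tau> x"
    using linear_fderiv_\<tau>[OF x] linear_conv_bounded_linear by blast
  have l: "((\<lambda>y. c2.f (\<tau> x, fderiv \<tau> x y)) has_derivative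
      (\<lambda>a. fderiv c2.f (\<tau> x, fderiv \<tau> x y) (0, fderiv \<tau> x a))) (at y)"
    by (rule has_derivative_compose[where f = "\<lambda>y. (\<tau> x, fderiv \<tau> x y)"])
       (use smooth_on_has_derivative[OF c2.smooth_F] \<tau>_image[OF x] fderiv_\<tau>_nonzero[OF x y] in
         \<open>auto intro!: derivative_eq_intros D.has_derivative\<close>)
  have "((\<lambda>y. c1.f (x, y)) has_derivative (\<lambda>a. fderiv c1.f (x, y) (0, a))) (at y)"
    by (rule has_derivative_compose[where f = "\<lambda>y. (x, y)"])
       (use smooth_on_has_derivative[OF c1.smooth_F] \<open>x \<in> U\<close> y in \<open>auto intro!: derivative_eq_intros\<close>)
  hence "((\<lambda>y. fderiv \<tau> x (c1.f (x, y))) has_derivative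
      (\<lambda>a. fderiv \<tau> x (fderiv c1.f (x, y) (0, a)))) (at y)"
    by (rule D.has_derivative)
  hence "((\<lambda>y. c2.f (\<tau> x, fderiv \<tau> x y)) has_derivative
      (\<lambda>a. fderiv \<tau> x (fderiv c1.f (x, y) (0, a)))) (at y)"
    by (rule has_derivative_transform_within_open[of _ _ _ _ "- {0}"]) (use y in \<open>auto simp: F_rule[OF x]\<close>)
  from fun_cong[OF has_derivative_unique[OF l this]] show ?thesis by simp
qed

text \<open>The correction in \<open>fderiv_g_rule\<close> is linear in \<open>y\<close>, so one
  more fibre derivative makes it independent of \<open>y\<close>. For \<open>a\<close> equal to
  \<open>sode\<close> it is the negative of the extra term in
  \<open>fderiv_sode_rule\<close>.\<close>

lemma fderiv2_g_rule:
  assumes x: "x \<in> W" and y: "y \<noteq> 0"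
  shows "fderiv2 c2.g (\<tau> x, fderiv \<tau> x y) (0, fderiv \<tau> x a) (0, fderiv \<tau> x b) =
    fderiv \<tau> x (fderiv2 c1.g (x, y) (0, a) (0, b)) - fderiv2 \<tau> x a b"
proof -
  have "x \<in> U" using x W_subset by blast
  interpret D: bounded_linear "fderiv \<tau> x"
    using linear_fderiv_\<tau>[OF x] linear_conv_bounded_linear by blast
  interpret D2: bounded_linear "fderiv2 \<tau> x a"
    using linear_fderiv2_\<tau>[OF x] linear_conv_bounded_linear by blast
  have l: "((\<lambda>y. fderiv c2.g (\<tau> x, fderiv \<tau> x y) (0, fderiv \<tau> x a)) has_derivative
      (\<lambda>b. fderiv2 c2.g (\<tau> x, fderiv \<tau> x y) (0, fderiv \<tau> x a) (0, fderiv \<tau> x b))) (at y)"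
    by (rule has_derivative_compose[where f = "\<lambda>y. (\<tau> x, fderiv \<tau> x y)"
          and g = "\<lambda>p. fderiv c2.g p (0, fderiv \<tau> x a)"])
       (use smooth_on_has_derivative[OF smooth_on_fderiv[OF c2.smooth_G]] \<tau>_image[OF x] fderiv_\<tau>_nonzero[OF x y] in
         \<open>auto intro!: derivative_eq_intros D.has_derivative\<close>)
  have "((\<lambda>y. fderiv c1.g (x, y) (0, a)) has_derivative (\<lambda>b. fderiv2 c1.g (x, y) (0, a) (0, b))) (at y)"
    by (rule has_derivative_compose[where f = "\<lambda>y. (x, y)" and g = "\<lambda>p. fderiv c1.g p (0, a)"])
       (use smooth_on_has_derivative[OF smooth_on_fderiv[OF c1.smooth_G]] \<open>x \<in> U\<close> y in
         \<open>auto intro!: derivative_eq_intros\<close>)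
  hence "((\<lambda>y. fderiv \<tau> x (fderiv c1.g (x, y) (0, a)) - fderiv2 \<tau> x a y) has_derivative
      (\<lambda>b. fderiv \<tau> x (fderiv2 c1.g (x, y) (0, a) (0, b)) - fderiv2 \<tau> x a b)) (at y)"
    by (intro has_derivative_diff D.has_derivative D2.has_derivative has_derivative_ident)
  hence "((\<lambda>y. fderiv c2.g (\<tau> x, fderiv \<tau> x y) (0, fderiv \<tau> x a)) has_derivative
      (\<lambda>b. fderiv \<tau> x (fderiv2 c1.g (x, y) (0, a) (0, b)) - fderiv2 \<tau> x a b)) (at y)"
    by (rule has_derivative_transform_within_open[of _ _ _ _ "- {0}"])
       (use y in \<open>auto simp: fderiv_g_rule[OF x] fderiv2_\<tau>_symmetric[OF x, of a]\<close>)
  from fun_cong[OF has_derivative_unique[OF l this]] show ?thesis by simp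
qed

text \<open>For \<open>delta_y1\<close>, the term \<open>fderiv2 \<tau> x y X\<close> in the
  transformed middle component meets its negative from \<open>fderiv_g_rule\<close>. For
  \<open>delta_y2\<close>, the cancellation is between the derivative of \<open>sode\<close> and the
  fibre Hessian of \<open>G\<close>.\<close>

lemma dual_coefficients_rule:
  fixes z :: "real^'n" and v :: "'n T2"
  assumes x: "x \<in> W" and y: "y \<noteq> 0"
  defines "q \<equiv> T2_map \<tau> (x, y, z)" and "w \<equiv> fderiv (T2_map \<tau>) (x, y, z) v"
  shows "delta_y1 (M1 G' F') q w = fderiv \<tau> x (delta_y1 (M1 G F) (x, y, z) v)"
    and "delta_y2 (M1 G' F') (M2 G' F') q w = fderiv \<tau> x (delta_y2 (M1 G F) (M2 G F) (x, y, z) v)"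
proof -
  obtain X Y Z where v: "v = (X, Y, Z)" by (cases v)
  have xU: "x \<in> U" using x W_subset by blast
  note x' = \<tau>_image[OF x] and y' = fderiv_\<tau>_nonzero[OF x y]
  interpret D: linear "fderiv \<tau> x" by (rule linear_fderiv_\<tau>[OF x])
  obtain K where "(T2_map \<tau> has_derivative
    (\<lambda>(X, Y, Z). (fderiv \<tau> x X, fderiv2 \<tau> x y X + fderiv \<tau> x Y, K (X, Y, Z)))) (at (x, y, z))"
    by (rule T2_map_has_derivative[OF smooth_\<tau> x])
  from fderivI[OF this] have w: "w = (fderiv \<tau> x X, fderiv2 \<tau> x y X + fderiv \<tau> x Y, K (X, Y, Z))"
    by (simp add: w_def v)
  obtain z' where q: "q = (\<tau> x, fderiv \<tau> x y, z')" using T2_map_eq[OF smooth_\<tau> x] q_def by blast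
  show "delta_y1 (M1 G' F') q w = fderiv \<tau> x (delta_y1 (M1 G F) (x, y, z) v)"
    by (simp add: q w v c1.delta_y1_eq[OF xU y] c2.delta_y1_eq[OF x' y'] fderiv_g_rule[OF x y]
        fderiv_f_rule[OF x y] D.add D.diff D.scale)
  have "2 *\<^sub>R delta_y2 (M1 G' F') (M2 G' F') q w
      = fderiv c2.sode q w + fderiv2 c2.g (\<tau> x, fderiv \<tau> x y) (0, c2.sode q) (0, fderiv \<tau> x X)"
    unfolding q w by (rule c2.delta_y2_eq[OF x' y'])
  \<comment> \<open>The term \<open>fderiv2 \<tau> x (c1.sode (x, y, z)) X\<close> occurs once with
    each sign.\<close>
  also have "\<dots> = fderiv \<tau> x (fderiv c1.sode (x, y, z) v)
      + fderiv \<tau> x (fderiv2 c1.g (x, y) (0, c1.sode (x, y, z)) (0, X))"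
    unfolding q_def sode_rule[OF x y] fderiv2_g_rule[OF x y]
    unfolding w_def v fderiv_sode_rule[OF x y] by simp
  also have "\<dots> = fderiv \<tau> x (2 *\<^sub>R delta_y2 (M1 G F) (M2 G F) (x, y, z) v)"
    unfolding v c1.delta_y2_eq[OF xU y] D.add ..
  finally show "delta_y2 (M1 G' F') (M2 G' F') q w = fderiv \<tau> x (delta_y2 (M1 G F) (M2 G F) (x, y, z) v)"
    by (simp add: D.scale)
qed

end


section \<open>Atlases and Jacobi fields\<close>

lemma smooth_manifold_chart:
  assumes "smooth_manifold X A" "\<kappa> \<in> A"
  shows "inj_on (snd \<kappa>) (fst \<kappa>)" and "open (snd \<kappa> ` fst \<kappa>)"
proof -
  have "openin X (fst \<kappa>)" and op: "open (snd \<kappa> ` fst \<kappa>)"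
    and h: "homeomorphic_map (subtopology X (fst \<kappa>)) (top_of_set (snd \<kappa> ` fst \<kappa>)) (snd \<kappa>)"
    using assms unfolding smooth_manifold_def by (auto simp: case_prod_unfold)
  have "topspace (subtopology X (fst \<kappa>)) = fst \<kappa>"
    using openin_subset[OF \<open>openin X (fst \<kappa>)\<close>] by auto
  thus "inj_on (snd \<kappa>) (fst \<kappa>)" using homeomorphic_imp_injective_map[OF h] by simp
  show "open (snd \<kappa> ` fst \<kappa>)" by (rule op)
qed

lemma smooth_manifold_transition:
  "smooth_manifold X A \<Longrightarrow> \<kappa> \<in> A \<Longrightarrow> \<kappa>' \<in> A \<Longrightarrow> smooth_on (transition \<kappa> \<kappa>') (overlap \<kappa> \<kappa>')"
  unfolding smooth_manifold_def by blast

lemma overlap_subset: "overlap \<kappa> \<kappa>' \<subseteq> snd \<kappa> ` fst \<kappa>"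
  by (auto simp: overlap_def)

lemma transition_inverse:
  assumes "smooth_manifold X A" "\<kappa> \<in> A" "\<kappa>' \<in> A" "x \<in> overlap \<kappa> \<kappa>'"
  shows "transition \<kappa> \<kappa>' x \<in> overlap \<kappa>' \<kappa>" "transition \<kappa>' \<kappa> (transition \<kappa> \<kappa>' x) = x"
proof -
  obtain p where p: "p \<in> fst \<kappa>" "p \<in> fst \<kappa>'" "x = snd \<kappa> p"
    using assms(4) by (auto simp: overlap_def)
  have "transition \<kappa> \<kappa>' x = snd \<kappa>' p"
    using p smooth_manifold_chart(1)[OF assms(1,2)] by (simp add: transition_def)
  thus "transition \<kappa> \<kappa>' x \<in> overlap \<kappa>' \<kappa>" "transition \<kappa>' \<kappa> (transition \<kappa> \<kappa>' x) = x"
    using p smooth_manifold_chart(1)[OF assms(1,3)] by (auto simp: transition_def overlap_def)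
qed

text \<open>The reverse transition is a left inverse on the overlap, so by the chain rule the
  derivative has a left inverse as well. Hence coordinate changes preserve the region
  \<open>y \<noteq> 0\<close> in which the coefficients are smooth.\<close>

lemma fderiv_transition_nonzero:
  assumes X: "smooth_manifold X A" and \<kappa>: "\<kappa> \<in> A" "\<kappa>' \<in> A" and x: "x \<in> overlap \<kappa> \<kappa>'" and y: "y \<noteq> 0"
  shows "fderiv (transition \<kappa> \<kappa>') x y \<noteq> 0"
proof
  assume 0: "fderiv (transition \<kappa> \<kappa>') x y = 0"
  let ?\<tau> = "transition \<kappa> \<kappa>'" and ?\<sigma> = "transition \<kappa>' \<kappa>"
  note s\<tau> = smooth_manifold_transition[OF X \<kappa>]
  note s\<sigma> = smooth_manifold_transition[OF X \<kappa>(2,1)]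
  have "((\<lambda>x. ?\<sigma> (?\<tau> x)) has_derivative (\<lambda>v. fderiv ?\<sigma> (?\<tau> x) (fderiv ?\<tau> x v))) (at x)"
    by (rule has_derivative_compose[OF smooth_on_has_derivative[OF s\<tau> x]
          smooth_on_has_derivative[OF s\<sigma> transition_inverse(1)[OF X \<kappa> x]]])
  hence "((\<lambda>x. x) has_derivative (\<lambda>v. fderiv ?\<sigma> (?\<tau> x) (fderiv ?\<tau> x v))) (at x)"
    by (rule has_derivative_transform_within_open[OF _ smooth_on_open[OF s\<tau>] x])
       (rule transition_inverse(2)[OF X \<kappa>])
  from fun_cong[OF has_derivative_unique[OF this has_derivative_ident], of y]
  have "fderiv ?\<sigma> (?\<tau> x) 0 = y" by (simp add: 0)
  thus False
    using y linear_0[OF smooth_on_linear_fderiv[OF s\<sigma> transition_inverse(1)[OF X \<kappa> x]]] by simp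
qed

lemma spray_chart_of_atlas:
  assumes "smooth_manifold X A" "spray A G" "d_vector_field A F" "\<kappa> \<in> A"
  shows "spray_chart (snd \<kappa> ` fst \<kappa>) (G \<kappa>) (F \<kappa>)"
  using assms smooth_manifold_chart(2)[OF assms(1,4)]
  unfolding spray_def d_vector_field_def spray_chart_def by blast

lemma spray_chart_change_of_atlas:
  assumes X: "smooth_manifold X A" and G: "spray A G" and F: "d_vector_field A F" and \<kappa>: "\<kappa> \<in> A" "\<kappa>' \<in> A"
  shows "spray_chart_change (snd \<kappa> ` fst \<kappa>) (snd \<kappa>' ` fst \<kappa>') (G \<kappa>) (F \<kappa>) (G \<kappa>') (F \<kappa>')
    (overlap \<kappa> \<kappa>') (transition \<kappa> \<kappa>')"
proof (rule spray_chart_change.intro)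
  show "spray_chart (snd \<kappa> ` fst \<kappa>) (G \<kappa>) (F \<kappa>)" "spray_chart (snd \<kappa>' ` fst \<kappa>') (G \<kappa>') (F \<kappa>')"
    using spray_chart_of_atlas[OF X G F] \<kappa> by blast+
  show "spray_chart_change_axioms (snd \<kappa> ` fst \<kappa>) (snd \<kappa>' ` fst \<kappa>') (G \<kappa>) (F \<kappa>) (G \<kappa>') (F \<kappa>')
    (overlap \<kappa> \<kappa>') (transition \<kappa> \<kappa>')"
  proof
    show "smooth_on (transition \<kappa> \<kappa>') (overlap \<kappa> \<kappa>')" by (rule smooth_manifold_transition[OF X \<kappa>])
    show "overlap \<kappa> \<kappa>' \<subseteq> snd \<kappa> ` fst \<kappa>" by (rule overlap_subset)
    fix x assume x: "x \<in> overlap \<kappa> \<kappa>'"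
    show "transition \<kappa> \<kappa>' x \<in> snd \<kappa>' ` fst \<kappa>'"
      using transition_inverse(1)[OF X \<kappa> x] overlap_subset by blast
    fix y :: "real^'b" assume y: "y \<noteq> 0"
    show "fderiv (transition \<kappa> \<kappa>') x y \<noteq> 0" by (rule fderiv_transition_nonzero[OF X \<kappa> x y])
    show "2 *\<^sub>R G \<kappa>' (transition \<kappa> \<kappa>' x) (fderiv (transition \<kappa> \<kappa>') x y) =
        fderiv (transition \<kappa> \<kappa>') x (2 *\<^sub>R G \<kappa> x y) - fderiv2 (transition \<kappa> \<kappa>') x y y"
      using G \<kappa> x y unfolding spray_def Let_def by blast
    show "F \<kappa>' (transition \<kappa> \<kappa>' x) (fderiv (transition \<kappa> \<kappa>') x y) = fderiv (transition \<kappa> \<kappa>') x (F \<kappa> x y)"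
      using F \<kappa> x y unfolding d_vector_field_def Let_def by blast
  qed
qed

lemma dual_coefficients_M1_M2:
  assumes "smooth_manifold X A" "spray A G" "d_vector_field A F"
  shows "dual_coefficients A (\<lambda>\<kappa>. M1 (G \<kappa>) (F \<kappa>)) (\<lambda>\<kappa>. M2 (G \<kappa>) (F \<kappa>))"
  unfolding dual_coefficients_def Let_def
  using spray_chart_change.dual_coefficients_rule[OF spray_chart_change_of_atlas[OF assms]] by blast

section \<open>Linearization of the system along a variation\<close>

lemma has_vector_derivative_slice:
  assumes "smooth_on f S" "(t, u) \<in> S"
  shows "((\<lambda>t. f (t, u)) has_vector_derivative fderiv f (t, u) (1, 0)) (at t)"
    and "((\<lambda>u. f (t, u)) has_vector_derivative fderiv f (t, u) (0, 1)) (at u)"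
proof -
  have "((\<lambda>t. (t, u)) has_vector_derivative (1, 0)) (at t)" "((\<lambda>u. (t, u)) has_vector_derivative (0, 1)) (at u)"
    by (auto intro!: has_vector_derivative_Pair derivative_eq_intros)
  from has_derivative_chain_curve[OF this(1) smooth_on_has_derivative[OF assms]]
    has_derivative_chain_curve[OF this(2) smooth_on_has_derivative[OF assms]]
  show "((\<lambda>t. f (t, u)) has_vector_derivative fderiv f (t, u) (1, 0)) (at t)"
    "((\<lambda>u. f (t, u)) has_vector_derivative fderiv f (t, u) (0, 1)) (at u)" .
qed

context spray_chart
begin

text \<open>Here \<open>a\<close> plays the role of time and \<open>b\<close> that of the variation
  parameter, so \<open>fderiv x p b\<close> is the deviation vector. The system, solved for the
  second time derivative, is differentiated along \<open>b\<close>, and commuting derivatives turns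
  the result into an equation for the deviation.\<close>

lemma linearized_equation:
  fixes x :: "'a::euclidean_space \<Rightarrow> real^'n"
  assumes x: "smooth_on x T" and p: "p \<in> T"
    and U: "\<And>q. q \<in> T \<Longrightarrow> x q \<in> U"
    and nz: "\<And>q. q \<in> T \<Longrightarrow> fderiv x q a \<noteq> 0"
    and eq: "\<And>q. q \<in> T \<Longrightarrow> sode (x q, fderiv x q a, (1/2) *\<^sub>R fderiv2 x q a a) = 0"
  defines "j \<equiv> (x p, fderiv x p a, (1/2) *\<^sub>R fderiv2 x p a a)"
  shows "(1/2) *\<^sub>R fderiv2 (\<lambda>q. fderiv x q b) p a a + M1 G F j *v fderiv2 x p b a
    + M2 G F j *v fderiv x p b = 0"
proof -
  note T = smooth_on_open[OF x] and xa = smooth_on_fderiv[OF x, of a]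
  note xp = U[OF p] nz[OF p]
  let ?P = "(x p, fderiv x p a)"
  have D: "((\<lambda>q. (x q, fderiv x q a)) has_derivative (\<lambda>v. (fderiv x p v, fderiv2 x p a v))) (at p)"
    by (intro has_derivative_Pair smooth_on_has_derivative[OF x p] smooth_on_has_derivative[OF xa p])
  have Dg: "((\<lambda>q. g (x q, fderiv x q a)) has_derivative (\<lambda>v. fderiv g ?P (fderiv x p v, fderiv2 x p a v))) (at p)"
    by (rule has_derivative_compose[OF D smooth_on_has_derivative[OF smooth_G]]) (use xp in simp)
  have Df: "((\<lambda>q. f (x q, fderiv x q a)) has_derivative (\<lambda>v. fderiv f ?P (fderiv x p v, fderiv2 x p a v))) (at p)"
    by (rule has_derivative_compose[OF D smooth_on_has_derivative[OF smooth_F]]) (use xp in simp)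
  have "((\<lambda>q. f (x q, fderiv x q a) - 2 *\<^sub>R g (x q, fderiv x q a)) has_derivative
      (\<lambda>v. fderiv f ?P (fderiv x p v, fderiv2 x p a v) - 2 *\<^sub>R fderiv g ?P (fderiv x p v, fderiv2 x p a v))) (at p)"
    by (intro has_derivative_diff has_derivative_scaleR_right Dg Df)
  \<comment> \<open>On the open set \<open>T\<close>, vanishing of \<open>sode\<close> identifies
    the function just differentiated with \<open>fderiv2 x q a a\<close>.\<close>
  hence "((\<lambda>q. fderiv2 x q a a) has_derivative
      (\<lambda>v. fderiv f ?P (fderiv x p v, fderiv2 x p a v) - 2 *\<^sub>R fderiv g ?P (fderiv x p v, fderiv2 x p a v))) (at p)"
    by (rule has_derivative_transform_within_open[OF _ T p])
       (use eq in \<open>force simp: sode_def algebra_simps\<close>)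
  from fun_cong[OF fderivI[OF this], of b]
  have 1: "fderiv (\<lambda>q. fderiv2 x q a a) p b
      = fderiv f ?P (fderiv x p b, fderiv2 x p a b) - 2 *\<^sub>R fderiv g ?P (fderiv x p b, fderiv2 x p a b)" .
  \<comment> \<open>Two interchanges: first of \<open>b\<close> with the inner \<open>a\<close>, as
    an identity on all of \<open>T\<close> that may be differentiated, then of \<open>b\<close> with
    the outer \<open>a\<close>.\<close>
  have "fderiv2 (\<lambda>q. fderiv x q b) p a a = fderiv (\<lambda>q. fderiv2 x q a b) p a"
    by (rule fun_cong[OF fderiv_cong_open[OF T p]]) (rule fderiv2_symmetric[OF x])
  also have "\<dots> = fderiv (\<lambda>q. fderiv2 x q a a) p b" by (rule fderiv2_symmetric[OF xa p])
  finally have 2: "fderiv2 (\<lambda>q. fderiv x q b) p a a = fderiv (\<lambda>q. fderiv2 x q a a) p b" .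
  have split: "h (v, w) = h (v, 0) + h (0, w)" if "linear h" for h :: "(real^'n) \<times> (real^'n) \<Rightarrow> real^'n" and v w
    using linear_add[OF that, of "(v, 0)" "(0, w)"] by simp
  \<comment> \<open>On a solution the Hessian term of \<open>M2\<close> has the argument
    \<open>sode = 0\<close>.\<close>
  have 0: "fderiv2 g ?P (0, sode j) w = 0" for w
    using linear_0[OF linear_fderiv2_g[OF xp]] eq[OF p]
    by (simp add: j_def fderiv2_g_symmetric[OF xp, of _ w] flip: zero_prod_def)
  have M1: "M1 G F j *v fderiv2 x p a b = fderiv g ?P (0, fderiv2 x p a b) - (1/2) *\<^sub>R fderiv f ?P (0, fderiv2 x p a b)"
    unfolding j_def by (rule M1_mult[OF xp])
  have M2: "M2 G F j *v fderiv x p b = fderiv g ?P (fderiv x p b, 0) - (1/2) *\<^sub>R fderiv f ?P (fderiv x p b, 0)"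
    using M2_mult[OF xp] 0[unfolded j_def] by (simp add: j_def)
  show ?thesis
    unfolding 2 1 fderiv2_symmetric[OF x p, of b] M1 M2
    by (simp add: split[OF linear_fderiv_g[OF xp], of "fderiv x p b" "fderiv2 x p a b"]
        split[OF linear_fderiv_f[OF xp], of "fderiv x p b" "fderiv2 x p a b"] algebra_simps)
qed

text \<open>By Euler's relation the sum over \<open>Mcoef\<close> is \<open>2 G\<close>, and the
  factor 2 before \<open>z\<close> in \<open>sode\<close> undoes the 1/2 in
  \<open>extension\<close>.\<close>

lemma sode_extension:
  assumes x: "x t \<in> U" "vel x t \<noteq> 0"
    and eq: "\<And>i. vel (vel x) t $ i + (\<Sum>j\<in>UNIV. Mcoef G i j (x t) (vel x t) * vel x t $ j) = F (x t) (vel x t) $ i"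
  shows "sode (extension x t) = 0"
  using eq by (simp add: sode_def extension_def vec_eq_iff euler_Mcoef[OF x, symmetric])

end

text \<open>Read in the chart, the variation is one smooth map \<open>x\<close> of
  \<open>(t, u)\<close>. Velocities along \<open>c\<close> and of \<open>w\<close> become
  derivatives of \<open>x\<close> in the directions \<open>?a\<close> and \<open>?b\<close> at
  \<open>u = 0\<close>, to which \<open>linearized_equation\<close> applies.\<close>

lemma jacobi_field_v2_component:
  assumes X: "smooth_manifold X A" and G: "spray A G" and F: "d_vector_field A F"
    and I: "open I" and jac: "jacobi_field X A G F I c w" and \<kappa>: "\<kappa> \<in> A" and t: "t \<in> I" "c t \<in> fst \<kappa>"
  shows "v2_component (M1 (G \<kappa>) (F \<kappa>)) (M2 (G \<kappa>) (F \<kappa>)) (snd \<kappa> \<circ> c) (w \<kappa>) t = 0"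
proof -
  obtain \<epsilon> V where jv: "jacobi_variation X A G F I c \<epsilon> V"
    and w: "\<And>s. s \<in> I \<Longrightarrow> c s \<in> fst \<kappa> \<Longrightarrow> w \<kappa> s = vector_derivative (\<lambda>u. snd \<kappa> (V s u)) (at 0)"
    using jac \<kappa> unfolding jacobi_field_def by blast
  define T where "T = {(t, u). t \<in> I \<and> u \<in> {-\<epsilon><..<\<epsilon>} \<and> V t u \<in> fst \<kappa>}"
  define x where "x = (\<lambda>(t, u). snd \<kappa> (V t u))"
  have eps: "\<epsilon> > 0" and x: "smooth_on x T" and V0: "\<And>s. s \<in> I \<Longrightarrow> V s 0 = c s"
    and sol: "\<And>u. u \<in> {-\<epsilon><..<\<epsilon>} \<Longrightarrow> solution_curve X A G F I (\<lambda>t. V t u)"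
    using jv \<kappa> unfolding jacobi_variation_def x_def T_def by blast+
  interpret spray_chart "snd \<kappa> ` fst \<kappa>" "G \<kappa>" "F \<kappa>"
    by (rule spray_chart_of_atlas[OF X G F \<kappa>])
  let ?a = "(1, 0) :: real \<times> real" and ?b = "(0, 1) :: real \<times> real"
  have xa: "smooth_on (\<lambda>q. fderiv x q v) T" for v by (rule smooth_on_fderiv[OF x])
  \<comment> \<open>For fixed \<open>u\<close> the admissible times form an open set, so a formula
    for a velocity on it can be differentiated again.\<close>
  have slice_open: "open {s. (s, u) \<in> T}" for u
    using open_vimage[OF smooth_on_open[OF x], of "\<lambda>s. (s, u)"] by (simp add: vimage_def continuous_intros)
  have vel1: "vel (\<lambda>s. x (s, u)) s = fderiv x (s, u) ?a" if "(s, u) \<in> T" for s u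
    by (rule vel_eqI[OF has_vector_derivative_slice(1)[OF x that]])
  have vel2: "vel (vel (\<lambda>s. x (s, u))) s = fderiv2 x (s, u) ?a ?a" if "(s, u) \<in> T" for s u
  proof -
    have "vel (vel (\<lambda>s. x (s, u))) s = vel (\<lambda>s. fderiv x (s, u) ?a) s"
      by (rule vel_cong_open[OF slice_open]) (use that vel1 in auto)
    thus ?thesis using vel_eqI[OF has_vector_derivative_slice(1)[OF xa that]] by simp
  qed
  have U: "x q \<in> snd \<kappa> ` fst \<kappa>" if "q \<in> T" for q using that by (auto simp: T_def x_def)
  \<comment> \<open>Every curve of the variation is a solution, so the equation holds on all of
    \<open>T\<close> and can be differentiated across the curves.\<close>
  have regular: "fderiv x q ?a \<noteq> 0" and eq: "sode (x q, fderiv x q ?a, (1/2) *\<^sub>R fderiv2 x q ?a ?a) = 0"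
    if "q \<in> T" for q
  proof -
    obtain s u where q: "q = (s, u)" by (cases q)
    have su: "s \<in> I" "u \<in> {-\<epsilon><..<\<epsilon>}" "V s u \<in> fst \<kappa>" using that by (auto simp: q T_def)
    have "snd \<kappa> \<circ> (\<lambda>t. V t u) = (\<lambda>s. x (s, u))" by (auto simp: x_def)
    hence "vel (\<lambda>s. x (s, u)) s \<noteq> 0 \<and> (\<forall>i. vel (vel (\<lambda>s. x (s, u))) s $ i +
        (\<Sum>j\<in>UNIV. Mcoef (G \<kappa>) i j (x (s, u)) (vel (\<lambda>s. x (s, u)) s) * vel (\<lambda>s. x (s, u)) s $ j)
        = F \<kappa> (x (s, u)) (vel (\<lambda>s. x (s, u)) s) $ i)"
      using sol[OF su(2)] su \<kappa> unfolding solution_curve_def Let_def by fastforce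
    thus "fderiv x q ?a \<noteq> 0" "sode (x q, fderiv x q ?a, (1/2) *\<^sub>R fderiv2 x q ?a ?a) = 0"
      using sode_extension[of "\<lambda>s. x (s, u)" s] U[OF that] that
      by (auto simp: q vel1 vel2 extension_def)
  qed
  \<comment> \<open>These are the times at which \<open>c\<close> lies in the chart. There
    \<open>c\<close> and \<open>w \<kappa>\<close> are expressed through \<open>x\<close>, and
    openness of the set carries this over to their first and second derivatives.\<close>
  let ?N = "{s. (s, 0) \<in> T}"
  note N = slice_open[of 0]
  have tN: "t \<in> ?N" using t eps V0 by (simp add: T_def)
  hence pT: "(t, 0) \<in> T" by simp
  have NI: "s \<in> I" "c s \<in> fst \<kappa>" if "s \<in> ?N" for s using that V0 by (auto simp: T_def)
  have xc: "vel (snd \<kappa> \<circ> c) s = vel (\<lambda>s. x (s, 0)) s" if "s \<in> ?N" for s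
    by (rule vel_cong_open[OF N that]) (use NI V0 in \<open>auto simp: x_def\<close>)
  have ext: "extension (snd \<kappa> \<circ> c) t = (x (t, 0), fderiv x (t, 0) ?a, (1/2) *\<^sub>R fderiv2 x (t, 0) ?a ?a)"
    using vel_cong_open[OF N tN xc] xc[OF tN] vel1[OF pT] vel2[OF pT] V0[OF t(1)]
    by (simp add: extension_def x_def)
  have w0: "w \<kappa> s = fderiv x (s, 0) ?b" if "s \<in> ?N" for s
    using vector_derivative_at[OF has_vector_derivative_slice(2)[OF x, of s 0]] w[OF NI[OF that]] that
    by (simp add: x_def)
  have w1: "vel (w \<kappa>) s = fderiv2 x (s, 0) ?b ?a" if "s \<in> ?N" for s
    using vel_cong_open[OF N that w0] vel_eqI[OF has_vector_derivative_slice(1)[OF xa, of s 0]] that by simp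
  have w2: "vel (vel (w \<kappa>)) t = fderiv2 (\<lambda>q. fderiv x q ?b) (t, 0) ?a ?a"
    using vel_cong_open[OF N tN w1]
      vel_eqI[OF has_vector_derivative_slice(1)[OF smooth_on_fderiv[OF xa] pT]] by simp
  show ?thesis
    unfolding v2_component_def ext w0[OF tN] w1[OF tN] w2
    by (rule linearized_equation[OF x pT U regular eq])
qed

theorem theorem6:
  fixes X :: "'a topology"
    and A :: "('a, 'n::finite) chart set"
    and G F :: "('a, 'n) chart \<Rightarrow> real^'n \<Rightarrow> real^'n \<Rightarrow> real^'n"
  assumes "smooth_manifold X A"
    and "spray A G"
    and "d_vector_field A F"
  shows "dual_coefficients A (\<lambda>\<kappa>. M1 (G \<kappa>) (F \<kappa>)) (\<lambda>\<kappa>. M2 (G \<kappa>) (F \<kappa>)) \<and>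
    (\<forall>I c w. open I \<and> is_interval I \<and> solution_curve X A G F I c \<and> jacobi_field X A G F I c w \<longrightarrow>
       (\<forall>\<kappa>\<in>A. \<forall>t\<in>I. c t \<in> fst \<kappa> \<longrightarrow>
          v2_component (M1 (G \<kappa>) (F \<kappa>)) (M2 (G \<kappa>) (F \<kappa>)) (snd \<kappa> \<circ> c) (w \<kappa>) t = 0))"
  using dual_coefficients_M1_M2[OF assms] jacobi_field_v2_component[OF assms] by blast

end
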